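(* Let $k$ and $\lambda$ be fixed positive integers such that $k\geq 2\lambda+1$ and let $s=\lfloor\frac{k-1}{\lambda}\rfloor$. For each real number $\epsilon>0$, there is an integer $v_0$ such that, for each integer $v\geq v_0$, any cyclic $(v,k,\lambda)$-design with $t$ orbits has a partial parallel class that contains exactly $s-1$ blocks from each of at most $\epsilon t$ orbits and contains exactly $s$ blocks from each other orbit.
   Context: A $(v,k,\lambda)$-design is a pair $(V,\mathcal{B})$ where $V$ is a set of $v$ points and $\mathcal{B}$ is a collection (repeated blocks allowed, so a multiset) of $k$-subsets of $V$ called blocks, such that every pair of distinct elements of $V$ is contained in precisely $\lambda$ blocks of $\mathcal{B}$, counted with multiplicity. An automorphism is a permutation of $V$ leaving $\mathcal{B}$ invariant. The design is cyclic if it admits an automorphism consisting of a single cycle of length $v$; we then identify $V$ with $\mathbb{Z}_v$ so that $\mathcal{B}$ is invariant under all translations $B\mapsto B+t$, $t\in\mathbb{Z}_v$. The blocks of a cyclic design are partitioned into orbits under $\mathbb{Z}_v$, where each orbit is the set $\{B+t : t\in\mathbb{Z}_v\}$ of distinct translates of some block $B$; if the blocks in such a set have multiplicity $\mu$ in $\mathcal{B}$, then this orbit is counted $\mu$ times (as $\mu$ separate orbits), and each block of $\mathcal{B}$ belongs to exactly one orbit. Orbits may be full (cardinality $v$) or short (cardinality less than $v$); both kinds are counted in $t$. A partial parallel class is a set of pairwise disjoint blocks of the design. *)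

theory Defs
  imports Complex_Main "HOL-Library.Multiset" "HOL-Combinatorics.Combinatorics"
begin

definition design :: "nat \<Rightarrow> nat \<Rightarrow> nat \<Rightarrow> 'a set \<Rightarrow> 'a set multiset \<Rightarrow> bool" where
  "design v k l V B \<longleftrightarrow>
     finite V \<and> card V = v \<and>
     (\<forall>b\<in>#B. b \<subseteq> V \<and> card b = k) \<and>
     (\<forall>x\<in>V. \<forall>y\<in>V. x \<noteq> y \<longrightarrow> size {#b \<in># B. x \<in> b \<and> y \<in> b#} = l)"

definition design_automorphism :: "'a set \<Rightarrow> 'a set multiset \<Rightarrow> ('a \<Rightarrow> 'a) \<Rightarrow> bool" where
  "design_automorphism V B \<sigma> \<longleftrightarrow> \<sigma> permutes V \<and> image_mset (\<lambda>b. \<sigma> ` b) B = B"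

text \<open>
  For a permutation \<open>\<sigma>\<close> of the finite set \<open>V\<close>, the library predicate \<^const>\<open>cyclic_on\<close> says that
  \<open>V\<close> is a single \<open>\<sigma>\<close>-orbit, so \<open>\<sigma>\<close> is one cycle of length \<^term>\<open>card V\<close>. Identifying \<open>V\<close> with
  the integers modulo \<^term>\<open>card V\<close> turns the powers of \<open>\<sigma>\<close> into the translations.
\<close>

definition cyclic_design ::
    "nat \<Rightarrow> nat \<Rightarrow> nat \<Rightarrow> 'a set \<Rightarrow> 'a set multiset \<Rightarrow> ('a \<Rightarrow> 'a) \<Rightarrow> bool" where
  "cyclic_design v k l V B \<sigma> \<longleftrightarrow>
     design v k l V B \<and> design_automorphism V B \<sigma> \<and> cyclic_on \<sigma> V"

text \<open>
  A block \<open>b\<close> of multiplicity \<open>\<mu>\<close> is represented by its \<open>\<mu>\<close> copies \<open>(b, i)\<close> with \<open>i < \<mu>\<close>.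
\<close>

definition block_copies :: "'a set multiset \<Rightarrow> ('a set \<times> nat) set" where
  "block_copies B = {(b, i). i < count B b}"

text \<open>
  Invariance of \<open>B\<close> makes the multiplicity constant on the translates of a block. Keeping the copy
  index fixed along an orbit therefore splits an orbit of multiplicity \<open>\<mu>\<close> into \<open>\<mu>\<close> separate orbits,
  and every block copy lies in exactly one orbit. Nonnegative powers of \<open>\<sigma>\<close> suffice because \<open>\<sigma>\<close>
  has finite order.
\<close>

definition block_orbits :: "('a \<Rightarrow> 'a) \<Rightarrow> 'a set multiset \<Rightarrow> ('a set \<times> nat) set set" where
  "block_orbits \<sigma> B = (\<lambda>(b, i). {((\<sigma> ^^ n) ` b, i) | n. True}) ` block_copies B"

text \<open>
  Two copies of the same nonempty block are not disjoint, so such a class uses each block at most once.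
\<close>

definition partial_parallel_class :: "'a set multiset \<Rightarrow> ('a set \<times> nat) set \<Rightarrow> bool" where
  "partial_parallel_class B P \<longleftrightarrow>
     P \<subseteq> block_copies B \<and> pairwise (\<lambda>p q. disjnt (fst p) (fst q)) P"

end

theory Submission
  imports Defs
begin

text \<open>
  Points, together with \<open>m\<close> copies of each orbit, are the vertices of a \<open>(k + 1)\<close>-uniform hypergraph
  whose edges join a block to a copy of its orbit; a matching in it is a partial parallel class using
  each orbit at most \<open>m\<close> times. Point degrees do not exceed orbit degrees when \<open>m \<le> (k - 1) / \<lambda>\<close>,
  and codegrees are bounded, so Pippenger's theorem gives a matching that misses few orbit copies.
  It is proved by the nibble, using only second moments.

  This alone could leave some orbits with fewer than \<open>s - 1\<close> blocks. So a random set \<open>U\<close> containing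
  each point with probability \<open>1 / s\<close> is set aside, and the first \<open>s - 1\<close> blocks of every orbit are
  chosen outside \<open>U\<close>. Almost every orbit has many blocks inside \<open>U\<close>, so the few missing blocks can be
  added greedily there, and a second matching in the rest of \<open>U\<close> gives almost every orbit an \<open>s\<close>-th
  block. The boundedly many orbits that are short or badly split by \<open>U\<close> are served first.
\<close>

subsection \<open>Random subsets\<close>

text \<open>Second moments suffice because the squared errors are summed before a set is fixed.
  There are O(v) orbits and points, every relevant count has variance O(v), so the total squared
  error is O(v^2), whereas one count that is off by a multiple of v already costs a multiple of v^2.
  Hence only boundedly many orbits and points misbehave. Bad points are deleted from the regions in
  which a matching is sought; bad orbits are charged to the allowed fraction of orbits, whose number
  grows linearly in v.

  The regions fit because a point lies on at most v / s blocks. With s - 1 copies of each orbit, a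
  point has degree at most about (s - 1) (v / s) (1 - p)^(k - 1) = v (1 - p)^k outside
  \<open>U\<close>, which is the expected number of blocks of a full orbit there. Orbits thus have
  essentially maximal degree, so a near-optimal matching almost saturates them.

  Two error scales are needed. Repairing the first matching consumes points of \<open>U\<close>, so
  its error \<open>e1\<close> must be far smaller than the error \<open>e3\<close> allowed for the
  second.\<close>

definition subset_expect :: "real \<Rightarrow> 'a set \<Rightarrow> ('a set \<Rightarrow> real) \<Rightarrow> real" where
  "subset_expect p A f = (\<Sum>S\<in>Pow A. p ^ card S * (1 - p) ^ card (A - S) * f S)"

lemma subset_expect_add: "subset_expect p A (\<lambda>S. f S + g S) = subset_expect p A f + subset_expect p A g"
  by (simp add: subset_expect_def algebra_simps sum.distrib)

lemma subset_expect_cmult: "subset_expect p A (\<lambda>S. c * f S) = c * subset_expect p A f"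
  by (simp add: subset_expect_def sum_distrib_left mult_ac)

lemma subset_expect_diff: "subset_expect p A (\<lambda>S. f S - g S) = subset_expect p A f - subset_expect p A g"
  by (simp add: subset_expect_def algebra_simps sum_subtractf)

lemma subset_expect_sum: "subset_expect p A (\<lambda>S. \<Sum>i\<in>I. f i S) = (\<Sum>i\<in>I. subset_expect p A (f i))"
  unfolding subset_expect_def by (simp add: sum_distrib_left) (rule sum.swap)

lemma subset_expect_mono:
  assumes "0 \<le> p" "p \<le> 1" "\<And>S. S \<subseteq> A \<Longrightarrow> f S \<le> g S"
  shows "subset_expect p A f \<le> subset_expect p A g"
  unfolding subset_expect_def using assms by (intro sum_mono mult_left_mono) auto

lemma subset_expect_compl:
  assumes "finite A"
  shows "subset_expect p A (\<lambda>S. f (A - S)) = subset_expect (1 - p) A f"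
  unfolding subset_expect_def
  by (rule sum.reindex_bij_witness[of _ "\<lambda>S. A - S" "\<lambda>S. A - S"]) (auto simp: double_diff mult_ac)

text \<open>The weights come from an expanded product: \<open>prod_add\<close> turns the product of
  \<open>?f a + ?g a\<close> into a sum over subsets \<open>S\<close>. Setting \<open>?f\<close> to
  0 on \<open>T\<close> and \<open>?g\<close> to 0 on \<open>P\<close> kills precisely the sets that
  violate the event.\<close>

lemma subset_expect_event:
  assumes "finite A" "P \<subseteq> A" "T \<subseteq> A" "P \<inter> T = {}"
  shows "subset_expect p A (\<lambda>S. of_bool (P \<subseteq> S \<and> S \<inter> T = {})) = p ^ card P * (1 - p) ^ card T"
proof -
  let ?f = "\<lambda>a. if a \<in> T then 0 else p" and ?g = "\<lambda>a. if a \<in> P then 0 else 1 - p"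
  have "(\<Prod>a\<in>A. ?f a + ?g a) = (\<Prod>a\<in>A. if a \<in> P then p else if a \<in> T then 1 - p else 1)"
    using assms(4) by (intro prod.cong) auto
  also have "\<dots> = (\<Prod>a\<in>P. p) * (\<Prod>a\<in>T. 1 - p)"
  proof -
    have "(\<Prod>a\<in>A. if a \<in> P then p else if a \<in> T then 1 - p else 1)
        = (\<Prod>a\<in>A. (if a \<in> P then p else 1) * (if a \<in> T then 1 - p else 1))"
      using assms(4) by (intro prod.cong) auto
    then show ?thesis
      using assms by (simp add: prod.distrib prod.If_cases Int_absorb1)
  qed
  finally have eq: "(\<Prod>a\<in>A. ?f a + ?g a) = p ^ card P * (1 - p) ^ card T" by simp
  have "(\<Prod>a\<in>S. ?f a) * (\<Prod>a\<in>A - S. ?g a)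
      = p ^ card S * (1 - p) ^ card (A - S) * of_bool (P \<subseteq> S \<and> S \<inter> T = {})"
    if "S \<subseteq> A" for S
  proof (cases "P \<subseteq> S \<and> S \<inter> T = {}")
    case True
    then have "(\<Prod>a\<in>S. ?f a) = (\<Prod>a\<in>S. p)" "(\<Prod>a\<in>A - S. ?g a) = (\<Prod>a\<in>A - S. 1 - p)"
      by (intro prod.cong; auto)+
    with True show ?thesis by simp
  next
    case False
    have fin: "finite S" "finite (A - S)" using that assms(1) finite_subset by auto
    from False consider a where "a \<in> P" "a \<notin> S" | a where "a \<in> S" "a \<in> T" by auto
    then have "(\<Prod>a\<in>S. ?f a) * (\<Prod>a\<in>A - S. ?g a) = 0"
    proof cases
      case 1
      then have "(\<Prod>a\<in>A - S. ?g a) = 0" using fin assms(2) by (intro prod_zero) auto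
      then show ?thesis by simp
    next
      case 2
      then have "(\<Prod>a\<in>S. ?f a) = 0" using fin by (intro prod_zero) auto
      then show ?thesis by simp
    qed
    with False show ?thesis by (auto simp del: mult_eq_0_iff)
  qed
  then show ?thesis
    unfolding subset_expect_def eq[symmetric] prod_add[OF assms(1)] by (intro sum.cong) auto
qed

lemma subset_expect_avoid:
  assumes "finite A" "T \<subseteq> A"
  shows "subset_expect p A (\<lambda>S. of_bool (S \<inter> T = {})) = (1 - p) ^ card T"
  using subset_expect_event[of A "{}" T p] assms by simp

lemma subset_expect_const:
  assumes "finite A"
  shows "subset_expect p A (\<lambda>S. c) = c"
  using subset_expect_cmult[of p A c "\<lambda>S. 1"] subset_expect_avoid[of A "{}" p] assms by simp

lemma subset_expect_ge_exists:
  assumes "finite A" "0 \<le> p" "p \<le> 1" "c \<le> subset_expect p A f"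
  shows "\<exists>S\<subseteq>A. c \<le> f S"
proof (rule ccontr)
  assume "\<not> ?thesis"
  then have lt: "f S < c" if "S \<subseteq> A" for S using that by (meson not_le)
  define m where "m = Max (f ` Pow A)"
  have fin: "finite (f ` Pow A)" and "f ` Pow A \<noteq> {}" using assms(1) by auto
  then have "m \<in> f ` Pow A" unfolding m_def by (rule Max_in)
  then have "m < c" using lt by auto
  have "subset_expect p A f \<le> subset_expect p A (\<lambda>S. m)"
    using fin assms by (intro subset_expect_mono) (auto simp: m_def)
  then show False using assms \<open>m < c\<close> subset_expect_const[OF assms(1), of p m] by simp
qed

lemma real_card_Collect:
  assumes "finite F"
  shows "real (card {f\<in>F. P f}) = (\<Sum>f\<in>F. of_bool (P f))"
proof -
  have "(\<Sum>f\<in>F. of_bool (P f) :: real) = (\<Sum>f\<in>{f\<in>F. P f}. 1)"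
    using assms by (intro sum.mono_neutral_cong_right) auto
  then show ?thesis by simp
qed

text \<open>Second moment of a sum of indicators. The label \<open>T f\<close> records where
  correlation may come from: disjoint labels mean independence up to \<open>\<tau>\<close>, and each
  pair with meeting labels is charged 1. A lower bound \<open>q\<close> on the single probabilities
  is enough because the mean enters with a negative coefficient.\<close>

lemma variance_count:
  fixes A :: "'a set" and T :: "'f \<Rightarrow> 'b set" and p q c \<tau> :: real
  assumes fin: "finite A" "finite F" and p: "0 \<le> p" "p \<le> 1" and q: "0 \<le> q" "0 \<le> \<tau>"
    and ex: "\<And>f. f \<in> F \<Longrightarrow> q \<le> subset_expect p A (\<lambda>S. of_bool (R f S))"
    and ex2: "\<And>f g. f \<in> F \<Longrightarrow> g \<in> F \<Longrightarrow> T f \<inter> T g = {} \<Longrightarrow>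
       subset_expect p A (\<lambda>S. of_bool (R f S \<and> R g S)) \<le> q * q + \<tau>"
    and meet: "\<And>f. f \<in> F \<Longrightarrow> real (card {g\<in>F. T f \<inter> T g \<noteq> {}}) \<le> c"
  shows "subset_expect p A (\<lambda>S. (real (card {f\<in>F. R f S}) - real (card F) * q)\<^sup>2)
    \<le> (c + real (card F) * \<tau>) * real (card F)"
proof -
  let ?N = "\<lambda>S. real (card {f\<in>F. R f S})" and ?n = "real (card F)"
  have EN: "subset_expect p A ?N \<ge> ?n * q"
    using ex by (simp add: real_card_Collect[OF fin(2)] subset_expect_sum sum_bounded_below)
  have pair: "subset_expect p A (\<lambda>S. of_bool (R f S \<and> R g S)) \<le> (q * q + \<tau>) + of_bool (T f \<inter> T g \<noteq> {})"
    if "f \<in> F" "g \<in> F" for f g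
  proof (cases "T f \<inter> T g = {}")
    case False
    have "subset_expect p A (\<lambda>S. of_bool (R f S \<and> R g S)) \<le> subset_expect p A (\<lambda>S. 1)"
      using p by (intro subset_expect_mono) auto
    then show ?thesis using False q subset_expect_const[OF fin(1), of p 1]
      by (simp add: add_increasing)
  qed (use ex2 that in simp)
  have "subset_expect p A (\<lambda>S. (?N S)\<^sup>2) = (\<Sum>f\<in>F. \<Sum>g\<in>F. subset_expect p A (\<lambda>S. of_bool (R f S \<and> R g S)))"
    by (simp add: real_card_Collect[OF fin(2)] power2_eq_square sum_product subset_expect_sum
        flip: of_bool_conj)
  also have "\<dots> \<le> (\<Sum>f\<in>F. \<Sum>g\<in>F. (q * q + \<tau>) + of_bool (T f \<inter> T g \<noteq> {}))"
    by (intro sum_mono pair)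
  also have "\<dots> = ?n * ?n * (q * q + \<tau>) + (\<Sum>f\<in>F. real (card {g\<in>F. T f \<inter> T g \<noteq> {}}))"
    by (simp add: sum.distrib real_card_Collect[OF fin(2)] algebra_simps)
  also have "\<dots> \<le> ?n * ?n * (q * q + \<tau>) + ?n * c"
    using sum_bounded_above[of F "\<lambda>f. real (card {g\<in>F. T f \<inter> T g \<noteq> {}})" c] meet by simp
  finally have EN2: "subset_expect p A (\<lambda>S. (?N S)\<^sup>2) \<le> ?n * ?n * (q * q + \<tau>) + ?n * c" .
  have "subset_expect p A (\<lambda>S. (?N S - ?n * q)\<^sup>2)
      = subset_expect p A (\<lambda>S. (?N S)\<^sup>2 - (2 * (?n * q)) * ?N S + (?n * q)\<^sup>2)"
    by (simp add: power2_diff algebra_simps)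
  also have "\<dots> = subset_expect p A (\<lambda>S. (?N S)\<^sup>2) - 2 * (?n * q) * subset_expect p A ?N + (?n * q)\<^sup>2"
    by (simp only: subset_expect_add subset_expect_diff subset_expect_cmult subset_expect_const[OF fin(1)])
  also have "\<dots> \<le> subset_expect p A (\<lambda>S. (?N S)\<^sup>2) - 2 * (?n * q) * (?n * q) + (?n * q)\<^sup>2"
    using mult_left_mono[OF EN, of "2 * (?n * q)"] q by simp
  finally show ?thesis using EN2 by (simp add: power2_eq_square algebra_simps)
qed

subsection \<open>Matchings in hypergraphs with small codegrees\<close>

text \<open>Edges are indices rather than vertex sets, so that copies of one block remain different
  edges.\<close>

definition matching_of :: "('e \<Rightarrow> 'b set) \<Rightarrow> 'e set \<Rightarrow> bool" where
  "matching_of V M \<longleftrightarrow> pairwise (\<lambda>e f. disjnt (V e) (V f)) M"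

text \<open>
  The random set is drawn from the edges together with dummy elements: a vertex of degree below
  \<open>n\<close> is topped up with private dummies \<open>Inr (x, i)\<close>, so that every vertex is hit by exactly \<open>n\<close>
  elements and survives with the same probability.
\<close>

locale nibble =
  fixes E :: "'e set" and V :: "'e \<Rightarrow> 'b set" and r n :: nat and p d :: real
  assumes finE: "finite E"
    and finV: "\<And>e. e \<in> E \<Longrightarrow> finite (V e)"
    and cardV: "\<And>e. e \<in> E \<Longrightarrow> card (V e) = r"
    and deg: "\<And>x. card {e\<in>E. x \<in> V e} \<le> n"
    and codeg: "\<And>x y. x \<noteq> y \<Longrightarrow> real (card {e\<in>E. x \<in> V e \<and> y \<in> V e}) \<le> d"
    and p: "0 \<le> p" "p \<le> 1" and r: "2 \<le> r" and d: "0 \<le> d"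
begin

definition inc :: "'b \<Rightarrow> ('e + 'b \<times> nat) set" where
  "inc x = Inl ` {e\<in>E. x \<in> V e} \<union> Inr ` ({x} \<times> {..<n - card {e\<in>E. x \<in> V e}})"

definition hit :: "'b set \<Rightarrow> ('e + 'b \<times> nat) set" where
  "hit T = (\<Union>x\<in>T. inc x)"

definition verts :: "'b set" where "verts = (\<Union>e\<in>E. V e)"

definition ground :: "('e + 'b \<times> nat) set" where "ground = hit verts"

definition chosen :: "('e + 'b \<times> nat) set \<Rightarrow> 'e set" where
  "chosen S = {e\<in>E. Inl e \<in> S \<and> S \<inter> (hit (V e) - {Inl e}) = {}}"

definition surv :: "('e + 'b \<times> nat) set \<Rightarrow> 'e set" where
  "surv S = {e\<in>E. S \<inter> hit (V e) = {}}"

text \<open>A stand-in for the new degree of \<open>x\<close>, given that \<open>x\<close> survives.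
  The elements at \<open>x\<close> itself are ignored, so an edge stays with probability about
  \<open>q ^ (r - 1)\<close>, where \<open>q = (1 - p) ^ n\<close>, instead of \<open>q ^ r\<close>;
  the edges surviving at \<open>x\<close> always belong to this set.\<close>

definition link :: "'b \<Rightarrow> ('e + 'b \<times> nat) set \<Rightarrow> 'e set" where
  "link x S = {e\<in>{e\<in>E. x \<in> V e}. S \<inter> (hit (V e - {x}) - inc x) = {}}"

section \<open>Counting the elements that hit a set of vertices\<close>

lemma finite_inc: "finite (inc x)"
  using finE by (auto simp: inc_def)

lemma card_inc: "card (inc x) = n"
proof -
  have "card (inc x) = card {e\<in>E. x \<in> V e} + card ({x} \<times> {..<n - card {e\<in>E. x \<in> V e}})"
    unfolding inc_def using finE
    by (subst card_Un_disjoint) (auto simp: card_image intro: finite_imageI)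
  then show ?thesis using deg[of x] by simp
qed

lemma finite_verts: "finite verts"
  using finE finV by (auto simp: verts_def)

lemma finite_hit: "finite T \<Longrightarrow> finite (hit T)"
  by (auto simp: hit_def finite_inc)

lemma finite_ground: "finite ground"
  by (simp add: ground_def finite_hit finite_verts)

lemma hit_subset: "e \<in> E \<Longrightarrow> T \<subseteq> V e \<Longrightarrow> hit T \<subseteq> ground"
  by (auto simp: ground_def hit_def verts_def)

lemma Inl_in_hit: "e \<in> E \<Longrightarrow> x \<in> V e \<Longrightarrow> x \<in> T \<Longrightarrow> Inl e \<in> hit T"
  by (auto simp: hit_def inc_def)

lemma card_inc_inter: "x \<noteq> y \<Longrightarrow> real (card (inc x \<inter> inc y)) \<le> d"
proof -
  assume xy: "x \<noteq> y"
  then have "inc x \<inter> inc y = Inl ` {e\<in>E. x \<in> V e \<and> y \<in> V e}"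
    by (auto simp: inc_def)
  then show ?thesis using codeg[OF xy] by (simp add: card_image)
qed

lemma card_hit_le: "finite T \<Longrightarrow> card (hit T) \<le> card T * n"
  using card_UN_le[of T inc] by (simp add: hit_def card_inc)

text \<open>Bonferroni: a new vertex shares at most \<open>d\<close> elements with each earlier one.
  The square is a crude bound for the number of pairs.\<close>

lemma card_hit_ge:
  assumes "finite T"
  shows "real (card T) * real n - (real (card T))\<^sup>2 * d \<le> real (card (hit T))"
  using assms
proof (induction T)
  case empty
  then show ?case by (simp add: hit_def)
next
  case (insert x T)
  have "real (card (hit T \<inter> inc x)) \<le> (\<Sum>y\<in>T. real (card (inc y \<inter> inc x)))"
    using card_UN_le[OF insert(1), of "\<lambda>y. inc y \<inter> inc x"]
    by (simp add: hit_def Int_UN_distrib2 flip: of_nat_sum)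
  also have "\<dots> \<le> (\<Sum>y\<in>T. d)" using insert(2) by (intro sum_mono card_inc_inter) auto
  finally have "real (card (hit T \<inter> inc x)) \<le> card T * d" by simp
  moreover have "card (hit (insert x T)) + card (hit T \<inter> inc x) = card (hit T) + n"
    using card_Un_Int[of "hit T" "inc x"] finite_hit[OF insert(1)] finite_inc[of x]
    by (simp add: card_inc hit_def Un_commute)
  then have "real (card (hit (insert x T))) + real (card (hit T \<inter> inc x)) = real (card (hit T)) + real n"
    by (metis of_nat_add)
  moreover have "(real (card T))\<^sup>2 * d + card T * d \<le> (real (card T) + 1)\<^sup>2 * d"
  proof -
    have "(real (card T) + 1)\<^sup>2 * d = (real (card T))\<^sup>2 * d + card T * d + (card T * d + d)"
      by (simp add: power2_eq_square algebra_simps)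
    then show ?thesis using d by simp
  qed
  moreover have "real (card (insert x T)) = real (card T) + 1" using insert by simp
  ultimately show ?case using insert.IH by (simp add: algebra_simps)
qed

text \<open>A chosen edge tolerates no other drawn element at its vertices, so it meets no other
  chosen edge; a surviving edge tolerates none at all.\<close>

lemma matching_chosen:
  assumes "M \<subseteq> surv S" "matching_of V M"
  shows "matching_of V (chosen S \<union> M)" and "chosen S \<inter> M = {}"
proof -
  have a: "disjnt (V e) (V f)" if "e \<in> chosen S" "f \<in> chosen S" "e \<noteq> f" for e f
    using that Inl_in_hit[of f _ "V e"] by (auto simp: chosen_def disjnt_def)
  have b: "disjnt (V e) (V f)" if "e \<in> chosen S" "f \<in> surv S" for e f
    using that Inl_in_hit[of e _ "V f"] by (auto simp: chosen_def surv_def disjnt_def)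
  show "matching_of V (chosen S \<union> M)"
    using assms a b unfolding matching_of_def pairwise_def by (blast intro: disjnt_sym)
  have "V e \<noteq> {}" if "e \<in> E" for e using cardV[OF that] r by auto
  then show "chosen S \<inter> M = {}"
    using b assms(1) by (fastforce simp: chosen_def disjnt_def)
qed

lemma expect_chosen:
  "real (card E) * (p * ((1 - p) ^ n) ^ r) \<le> subset_expect p ground (\<lambda>S. real (card (chosen S)))"
proof -
  have "p * ((1 - p) ^ n) ^ r \<le> subset_expect p ground (\<lambda>S. of_bool (Inl e \<in> S \<and> S \<inter> (hit (V e) - {Inl e}) = {}))"
    if e: "e \<in> E" for e
  proof -
    have "V e \<noteq> {}" using cardV[OF e] r by auto
    then have "Inl e \<in> hit (V e)" using Inl_in_hit[OF e] by blast
    then have "Inl e \<in> ground" using hit_subset[OF e order_refl] by auto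
    then have "subset_expect p ground (\<lambda>S. of_bool ({Inl e} \<subseteq> S \<and> S \<inter> (hit (V e) - {Inl e}) = {}))
        = p ^ card {Inl e :: 'e + 'b \<times> nat} * (1 - p) ^ card (hit (V e) - {Inl e})"
      using hit_subset[OF e order_refl] by (intro subset_expect_event finite_ground) auto
    moreover have "card (hit (V e) - {Inl e}) \<le> n * r"
      using card_hit_le[OF finV[OF e]] card_Diff1_le[of "hit (V e)" "Inl e"]
      by (simp add: cardV[OF e] mult.commute)
    then have "(1 - p) ^ (n * r) \<le> (1 - p) ^ card (hit (V e) - {Inl e})"
      using p by (intro power_decreasing) auto
    ultimately show ?thesis using p by (simp add: power_mult mult_left_mono)
  qed
  then show ?thesis
    unfolding chosen_def real_card_Collect[OF finE] subset_expect_sum by (intro sum_bounded_below)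
qed

lemma expect_surv:
  "real (card E) * ((1 - p) ^ n) ^ r \<le> subset_expect p ground (\<lambda>S. real (card (surv S)))"
proof -
  have "((1 - p) ^ n) ^ r \<le> subset_expect p ground (\<lambda>S. of_bool (S \<inter> hit (V e) = {}))"
    if e: "e \<in> E" for e
  proof -
    have "card (hit (V e)) \<le> n * r"
      using card_hit_le[OF finV[OF e]] by (simp add: cardV[OF e] mult.commute)
    then have "(1 - p) ^ (n * r) \<le> (1 - p) ^ card (hit (V e))"
      using p by (intro power_decreasing) auto
    then show ?thesis
      using subset_expect_avoid[OF finite_ground hit_subset[OF e order_refl], of p] by (simp add: power_mult)
  qed
  then show ?thesis
    unfolding surv_def real_card_Collect[OF finE] subset_expect_sum by (intro sum_bounded_below)
qed

text \<open>Two edges at \<open>x\<close> that meet nowhere else survive almost independently: the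
  elements to be avoided for one and for the other overlap only through codegrees. The variance is
  therefore of order \<open>d\<close> times the degree, not the degree squared.\<close>

lemma variance_link:
  assumes small: "p * n \<le> 1" "2 * (p * (2 * real r)\<^sup>2 * d) \<le> 1"
  shows "subset_expect p ground (\<lambda>S. (real (card (link x S)) - real (card {e\<in>E. x \<in> V e}) * ((1 - p) ^ n) ^ (r - 1))\<^sup>2)
    \<le> 9 * (real r)\<^sup>2 * d * real (card {e\<in>E. x \<in> V e})"
proof -
  define F where "F = {e\<in>E. x \<in> V e}"
  define q where "q = ((1 - p) ^ n) ^ (r - 1)"
  define \<kappa> where "\<kappa> = p * (2 * real r)\<^sup>2 * d"
  have q: "0 \<le> q" "q \<le> 1" using p by (auto simp: q_def power_le_one)
  have \<kappa>: "0 \<le> \<kappa>" "2 * \<kappa> \<le> 1" using small p d by (auto simp: \<kappa>_def)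
  have finF: "finite F" using finE by (simp add: F_def)
  have FE: "e \<in> E" "x \<in> V e" if "e \<in> F" for e using that by (auto simp: F_def)
  have cl: "card (hit (V e - {x}) - inc x) \<le> n * (r - 1)" if "e \<in> F" for e
  proof -
    have "card (hit (V e - {x}) - inc x) \<le> card (hit (V e - {x}))"
      using finV[OF FE(1)[OF that]] by (intro card_mono finite_hit) auto
    also have "\<dots> \<le> n * (r - 1)"
      using card_hit_le[of "V e - {x}"] finV[OF FE(1)[OF that]] FE[OF that] cardV[OF FE(1)[OF that]]
      by (simp add: mult.commute)
    finally show ?thesis .
  qed
  have sub: "hit (V e - {x}) - inc x \<subseteq> ground" if "e \<in> F" for e
    using hit_subset[OF FE(1)[OF that], of "V e - {x}"] by auto
  have "subset_expect p ground (\<lambda>S. (real (card {e\<in>F. S \<inter> (hit (V e - {x}) - inc x) = {}}) - real (card F) * q)\<^sup>2)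
    \<le> (real r * d + real (card F) * (2 * \<kappa>)) * real (card F)"
  proof (rule variance_count[where T = "\<lambda>e. V e - {x}"])
    fix e assume e: "e \<in> F"
    have "q = (1 - p) ^ (n * (r - 1))" by (simp add: q_def power_mult)
    also have "\<dots> \<le> (1 - p) ^ card (hit (V e - {x}) - inc x)"
      using p cl[OF e] by (intro power_decreasing) auto
    finally show "q \<le> subset_expect p ground (\<lambda>S. of_bool (S \<inter> (hit (V e - {x}) - inc x) = {}))"
      by (simp add: subset_expect_avoid[OF finite_ground sub[OF e]])
    have "{g\<in>F. (V e - {x}) \<inter> (V g - {x}) \<noteq> {}} \<subseteq> (\<Union>y\<in>V e - {x}. {g\<in>E. x \<in> V g \<and> y \<in> V g})"
      by (auto simp: F_def)
    then have "card {g\<in>F. (V e - {x}) \<inter> (V g - {x}) \<noteq> {}} \<le> card (\<Union>y\<in>V e - {x}. {g\<in>E. x \<in> V g \<and> y \<in> V g})"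
      using finE finV[OF FE(1)[OF e]] by (intro card_mono) auto
    also have "\<dots> \<le> (\<Sum>y\<in>V e - {x}. card {g\<in>E. x \<in> V g \<and> y \<in> V g})"
      using finV[OF FE(1)[OF e]] by (intro card_UN_le) auto
    finally have "real (card {g\<in>F. (V e - {x}) \<inter> (V g - {x}) \<noteq> {}})
        \<le> (\<Sum>y\<in>V e - {x}. real (card {g\<in>E. x \<in> V g \<and> y \<in> V g}))"
      by (simp flip: of_nat_sum)
    also have "\<dots> \<le> (\<Sum>y\<in>V e - {x}. d)" by (intro sum_mono codeg) auto
    also have "\<dots> = real (r - 1) * d" using FE[OF e] cardV[OF FE(1)[OF e]] by simp
    also have "\<dots> \<le> real r * d" using d by (intro mult_right_mono) auto
    finally show "real (card {g\<in>F. (V e - {x}) \<inter> (V g - {x}) \<noteq> {}}) \<le> real r * d" .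
  next
    fix e g assume e: "e \<in> F" and g: "g \<in> F" and dis: "(V e - {x}) \<inter> (V g - {x}) = {}"
    let ?A = "hit (V e - {x}) - inc x" and ?B = "hit (V g - {x}) - inc x"
    have fine: "finite (V e)" "finite (V g)" using finV FE e g by auto
    have U: "?A \<union> ?B = hit (V e \<union> V g) - inc x" by (auto simp: hit_def)
    have xU: "x \<in> V e \<union> V g" using FE[OF e] by simp
    have ins: "V e \<union> V g = insert x ((V e - {x}) \<union> (V g - {x}))" using FE[OF e] by auto
    have card_U: "card (V e \<union> V g) = 2 * r - 1"
      unfolding ins using dis fine FE[OF e] FE[OF g] cardV[OF FE(1)[OF e]] cardV[OF FE(1)[OF g]] r
      by (subst card_insert_disjoint) (auto simp: card_Un_disjoint)
    have "inc x \<subseteq> hit (V e \<union> V g)" using xU by (auto simp: hit_def)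
    then have cU: "real (card (?A \<union> ?B)) = real (card (hit (V e \<union> V g))) - n"
      unfolding U using card_mono[of "hit (V e \<union> V g)" "inc x"] fine
      by (simp add: card_Diff_subset finite_inc card_inc finite_hit of_nat_diff)
    have r1: "real (2 * r - 1) = 2 * real r - 1" "real (2 * (r - 1)) = 2 * real r - 2" using r by auto
    have "(2 * real r - 1)\<^sup>2 \<le> (2 * real r)\<^sup>2" using r by (intro power_mono) auto
    then have "(2 * real r - 1)\<^sup>2 * d \<le> (2 * real r)\<^sup>2 * d" using d by (intro mult_right_mono)
    then have "(2 * real r - 1) * n - (2 * real r)\<^sup>2 * d \<le> real (card (hit (V e \<union> V g)))"
      using card_hit_ge[of "V e \<union> V g"] fine by (simp add: card_U r1[unfolded One_nat_def])
    then have lower: "real (2 * (r - 1)) * n - (2 * real r)\<^sup>2 * d \<le> real (card (?A \<union> ?B))"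
      unfolding cU r1 by (simp add: algebra_simps)
    have upper: "card (?A \<union> ?B) \<le> n * (2 * (r - 1))"
      using card_Un_le[of ?A ?B] cl[OF e] cl[OF g] by simp
    \<comment> \<open>\<open>j\<close> is the shortfall of the union from the maximal size. Avoiding
      \<open>j\<close> further elements would bring the probability \<open>P\<close> down to exactly
      \<open>q * q\<close>, so Bernoulli yields \<open>P * (1 - \<kappa>) \<le> q * q\<close>; as
      \<open>2 * \<kappa> \<le> 1\<close>, the factor \<open>1 - \<kappa>\<close> can be traded for
      \<open>1 + 2 * \<kappa>\<close>.\<close>
    define j where "j = n * (2 * (r - 1)) - card (?A \<union> ?B)"
    have j: "card (?A \<union> ?B) + j = n * (2 * (r - 1))" using upper by (simp add: j_def)
    then have "real (card (?A \<union> ?B)) + real j = real n * real (2 * (r - 1))"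
      by (metis of_nat_add of_nat_mult)
    then have "real j \<le> (2 * real r)\<^sup>2 * d" using lower by (simp add: algebra_simps)
    then have "p * real j \<le> \<kappa>" using p by (simp add: \<kappa>_def mult.assoc mult_left_mono)
    moreover have "1 + real j * (- p) \<le> (1 + (- p)) ^ j"
      using p by (intro Bernoulli_inequality) auto
    ultimately have pj: "1 - \<kappa> \<le> (1 - p) ^ j" by (simp add: mult.commute)
    define P where "P = (1 - p) ^ card (?A \<union> ?B)"
    have P: "0 \<le> P" using p by (simp add: P_def)
    have "P * (1 - \<kappa>) \<le> P * (1 - p) ^ j" using pj P by (intro mult_left_mono)
    also have "\<dots> = q * q"
    proof -
      have "P * (1 - p) ^ j = (1 - p) ^ (n * (2 * (r - 1)))" by (simp add: P_def j flip: power_add)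
      then show ?thesis by (simp add: q_def power_mult mult.commute[of 2] power2_eq_square)
    qed
    finally have PQ: "P * (1 - \<kappa>) \<le> q * q" .
    have "1 \<le> (1 - \<kappa>) * (1 + 2 * \<kappa>)" using \<kappa> mult_left_mono[of "2 * \<kappa>" 1 \<kappa>]
      by (simp add: algebra_simps)
    then have "P * 1 \<le> P * ((1 - \<kappa>) * (1 + 2 * \<kappa>))" using P by (intro mult_left_mono)
    also have "\<dots> \<le> q * q * (1 + 2 * \<kappa>)"
      using mult_right_mono[OF PQ, of "1 + 2 * \<kappa>"] \<kappa> by (simp add: mult.assoc)
    also have "\<dots> \<le> q * q + 2 * \<kappa>"
      using mult_mono[of q 1 q 1] q mult_right_mono[of "q * q" 1 "2 * \<kappa>"] \<kappa> by (simp add: algebra_simps)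
    finally have "P \<le> q * q + 2 * \<kappa>" by simp
    moreover have "(S \<inter> ?A = {} \<and> S \<inter> ?B = {}) = (S \<inter> (?A \<union> ?B) = {})" for S by blast
    ultimately show "subset_expect p ground (\<lambda>S. of_bool (S \<inter> ?A = {} \<and> S \<inter> ?B = {})) \<le> q * q + 2 * \<kappa>"
      using subset_expect_avoid[OF finite_ground, of "?A \<union> ?B" p] sub[OF e] sub[OF g] by (simp add: P_def)
  qed (use p q \<kappa> finF finite_ground in auto)
  also have "\<dots> \<le> (9 * (real r)\<^sup>2 * d) * real (card F)"
  proof (rule mult_right_mono)
    have "real (card F) * p \<le> 1"
      using small(1) deg[of x] p mult_right_mono[of "real (card F)" "real n" p]
      by (simp add: F_def mult.commute)
    \<comment> \<open>Since \<open>2 * \<kappa>\<close> is 8 p r^2 d and \<open>F\<close> has at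
      most 1 / p edges, the correlation error sums to 8 r^2 d. The pairs that meet outside
      \<open>x\<close> contribute one more r^2 d, whence the 9.\<close>
    then have "(real (card F) * p) * (8 * (real r)\<^sup>2 * d) \<le> 1 * (8 * (real r)\<^sup>2 * d)"
      using d by (intro mult_right_mono) auto
    then have "real (card F) * (2 * \<kappa>) \<le> 8 * (real r)\<^sup>2 * d"
      by (simp add: \<kappa>_def power2_eq_square algebra_simps)
    moreover have "real r * 1 \<le> real r * real r" using r by (intro mult_left_mono) auto
    then have "real r * d \<le> (real r)\<^sup>2 * d" using d by (simp add: power2_eq_square mult_right_mono)
    ultimately show "real r * d + real (card F) * (2 * \<kappa>) \<le> 9 * (real r)\<^sup>2 * d" by (simp add: algebra_simps)
  qed simp
  finally show ?thesis by (simp add: link_def F_def q_def)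
qed

text \<open>Discarding every edge at an overfull vertex restores a strict degree bound, as the next
  round requires. The variance bounds how many edges this costs.\<close>

definition trimmed :: "real \<Rightarrow> ('e + 'b \<times> nat) set \<Rightarrow> 'e set" where
  "trimmed D S = {e\<in>surv S. \<forall>x\<in>V e. real (card {f\<in>surv S. x \<in> V f}) \<le> D}"

lemma sum_degrees: "(\<Sum>x\<in>verts. card {e\<in>E. x \<in> V e}) = r * card E"
proof -
  have "(\<Sum>x\<in>verts. card {e\<in>E. x \<in> V e}) = (\<Sum>e\<in>E. card {x\<in>verts. x \<in> V e})"
    using finE finite_verts by (intro sum_multicount_gen) auto
  also have "\<dots> = (\<Sum>e\<in>E. r)"
    by (intro sum.cong refl) (use cardV in \<open>auto simp: verts_def intro!: arg_cong[where f = card]\<close>)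
  finally show ?thesis by simp
qed

text \<open>One outcome \<open>S\<close> must be good both for the edges chosen now and for those
  kept for later, so the two counts are combined with a weight \<open>c\<close> and only one
  expectation is compared.\<close>

lemma nibble_round:
  fixes c \<eta> D :: real
  defines "q \<equiv> (1 - p) ^ n"
  defines "\<mu> \<equiv> D * q ^ (r - 1)"
  assumes small: "p * n \<le> 1" "2 * (p * (2 * real r)\<^sup>2 * d) \<le> 1"
    and D: "real n \<le> D" and \<eta>: "0 < \<eta>" and \<mu>: "0 < \<mu>" and c: "0 \<le> c"
  shows "\<exists>S. real (card E) * (p * q ^ r + c * (q ^ r - (1 + \<eta>) / (\<eta>\<^sup>2 * \<mu>) * (9 * real r ^ 3 * d)))
    \<le> real (card (chosen S)) + c * real (card (trimmed ((1 + \<eta>) * \<mu>) S))"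
proof -
  define K where "K = (1 + \<eta>) / (\<eta>\<^sup>2 * \<mu>)"
  have K: "0 \<le> K" using \<eta> \<mu> by (simp add: K_def)
  define W where "W = (\<lambda>x S. (real (card (link x S)) - real (card {e\<in>E. x \<in> V e}) * q ^ (r - 1))\<^sup>2)"
  have q0: "0 \<le> q" using p by (simp add: q_def)
  \<comment> \<open>From \<open>N > (1 + \<eta>) * \<mu> \<ge> (1 + \<eta>) * m\<close> follows
    \<open>\<eta> * N \<le> (1 + \<eta>) * (N - m)\<close>. Squaring, and replacing one factor
    \<open>N\<close> by its lower bound, bounds the edges at an overfull vertex, rather than merely
    the number of such vertices, by the squared deviation.\<close>
  have excess: "real (card {f\<in>surv S. x \<in> V f}) \<le> K * W x S"
    if "(1 + \<eta>) * \<mu> < real (card {f\<in>surv S. x \<in> V f})" for x S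
  proof -
    define N where "N = real (card (link x S))"
    define m where "m = real (card {e\<in>E. x \<in> V e}) * q ^ (r - 1)"
    have "{f\<in>surv S. x \<in> V f} \<subseteq> link x S" by (auto simp: surv_def link_def hit_def)
    then have le: "real (card {f\<in>surv S. x \<in> V f}) \<le> N"
      using finE by (auto simp: link_def N_def intro: card_mono)
    with that have N: "(1 + \<eta>) * \<mu> < N" by simp
    have "real (card {e\<in>E. x \<in> V e}) \<le> D" using deg[of x] D by linarith
    then have m: "0 \<le> m" "m \<le> \<mu>" using q0 by (auto simp: m_def \<mu>_def intro: mult_right_mono)
    have "(1 + \<eta>) * m \<le> (1 + \<eta>) * \<mu>" using m \<eta> by (intro mult_left_mono) auto
    then have "\<eta> * N \<le> (1 + \<eta>) * (N - m)" using N by (simp add: algebra_simps)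
    moreover have N0: "0 \<le> N" by (simp add: N_def)
    ultimately have "(\<eta> * N)\<^sup>2 \<le> ((1 + \<eta>) * (N - m))\<^sup>2" using \<eta> by (intro power_mono) auto
    moreover have "\<eta>\<^sup>2 * N * ((1 + \<eta>) * \<mu>) \<le> \<eta>\<^sup>2 * N * N"
      using N N0 by (intro mult_left_mono) auto
    ultimately have "(1 + \<eta>) * (\<eta>\<^sup>2 * N * \<mu>) \<le> (1 + \<eta>) * ((1 + \<eta>) * (N - m)\<^sup>2)"
      by (simp add: power2_eq_square algebra_simps)
    then have "\<eta>\<^sup>2 * N * \<mu> \<le> (1 + \<eta>) * (N - m)\<^sup>2" using \<eta> by simp
    then have "N \<le> K * (N - m)\<^sup>2" using \<eta> \<mu> by (simp add: K_def field_simps)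
    then show ?thesis using le by (simp add: W_def N_def m_def)
  qed
  have loss: "real (card (surv S)) - (\<Sum>x\<in>verts. K * W x S) \<le> real (card (trimmed ((1 + \<eta>) * \<mu>) S))" for S
  proof -
    let ?bad = "{x\<in>verts. (1 + \<eta>) * \<mu> < real (card {f\<in>surv S. x \<in> V f})}"
    have finS: "finite (surv S)" using finE by (simp add: surv_def)
    have "surv S \<subseteq> trimmed ((1 + \<eta>) * \<mu>) S \<union> (\<Union>x\<in>?bad. {f\<in>surv S. x \<in> V f})"
      by (auto simp: trimmed_def surv_def verts_def not_le)
    moreover have "finite (trimmed ((1 + \<eta>) * \<mu>) S \<union> (\<Union>x\<in>?bad. {f\<in>surv S. x \<in> V f}))"
      using finS finite_verts by (auto simp: trimmed_def)
    ultimately have "card (surv S) \<le> card (trimmed ((1 + \<eta>) * \<mu>) S \<union> (\<Union>x\<in>?bad. {f\<in>surv S. x \<in> V f}))"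
      by (rule card_mono[rotated])
    also have "\<dots> \<le> card (trimmed ((1 + \<eta>) * \<mu>) S) + card (\<Union>x\<in>?bad. {f\<in>surv S. x \<in> V f})"
      by (rule card_Un_le)
    also have "\<dots> \<le> card (trimmed ((1 + \<eta>) * \<mu>) S) + (\<Sum>x\<in>?bad. card {f\<in>surv S. x \<in> V f})"
      using finite_verts by (intro add_left_mono card_UN_le) auto
    finally have "real (card (surv S)) \<le> real (card (trimmed ((1 + \<eta>) * \<mu>) S))
        + (\<Sum>x\<in>?bad. real (card {f\<in>surv S. x \<in> V f}))"
      by (simp flip: of_nat_sum of_nat_add)
    moreover have "(\<Sum>x\<in>?bad. real (card {f\<in>surv S. x \<in> V f})) \<le> (\<Sum>x\<in>?bad. K * W x S)"
      by (intro sum_mono excess) auto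
    moreover have "(\<Sum>x\<in>?bad. K * W x S) \<le> (\<Sum>x\<in>verts. K * W x S)"
      using finite_verts K by (intro sum_mono2) (auto simp: W_def)
    ultimately show ?thesis by linarith
  qed
  \<comment> \<open>The trimmed count is replaced by its lower bound from \<open>loss\<close>, whose
    expectation is accessible by linearity.\<close>
  let ?f = "\<lambda>S. real (card (chosen S)) + c * (real (card (surv S)) - (\<Sum>x\<in>verts. K * W x S))"
  have "(\<Sum>x\<in>verts. K * subset_expect p ground (W x))
      \<le> (\<Sum>x\<in>verts. K * (9 * (real r)\<^sup>2 * d * real (card {e\<in>E. x \<in> V e})))"
    using K variance_link[OF small] by (intro sum_mono mult_left_mono) (auto simp: W_def q_def)
  also have "\<dots> = K * (9 * (real r)\<^sup>2 * d) * real (\<Sum>x\<in>verts. card {e\<in>E. x \<in> V e})"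
    by (simp add: sum_distrib_left mult_ac)
  also have "\<dots> = K * (9 * real r ^ 3 * d) * real (card E)"
    unfolding sum_degrees by (simp add: power2_eq_square power3_eq_cube)
  finally have W: "(\<Sum>x\<in>verts. K * subset_expect p ground (W x)) \<le> K * (9 * real r ^ 3 * d) * real (card E)" .
  have "real (card E) * (p * q ^ r + c * (q ^ r - K * (9 * real r ^ 3 * d)))
      = real (card E) * (p * q ^ r) + c * (real (card E) * q ^ r - K * (9 * real r ^ 3 * d) * real (card E))"
    by (simp add: algebra_simps)
  also have "\<dots> \<le> subset_expect p ground (\<lambda>S. real (card (chosen S)))
      + c * (subset_expect p ground (\<lambda>S. real (card (surv S))) - (\<Sum>x\<in>verts. K * subset_expect p ground (W x)))"
    using expect_chosen expect_surv W c unfolding q_def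
    by (intro add_mono mult_left_mono diff_mono)
  also have "\<dots> = subset_expect p ground ?f"
    by (simp add: subset_expect_add subset_expect_cmult subset_expect_diff subset_expect_sum)
  finally obtain S where "real (card E) * (p * q ^ r + c * (q ^ r - K * (9 * real r ^ 3 * d))) \<le> ?f S"
    using subset_expect_ge_exists[OF finite_ground p] by blast
  also have "?f S \<le> real (card (chosen S)) + c * real (card (trimmed ((1 + \<eta>) * \<mu>) S))"
    using loss c by (intro add_left_mono mult_left_mono)
  finally show ?thesis unfolding K_def by blast
qed

end

text \<open>The matching is measured against \<open>card E / D\<close>, and degrees are bounded from
  above only. The property then passes to the trimmed hypergraph, which may be irregular; fixing
  \<open>V\<close> and quantifying over \<open>E\<close> lets the induction move to a subset of the
  edges.\<close>

definition matching_fraction :: "('e \<Rightarrow> 'b set) \<Rightarrow> nat \<Rightarrow> real \<Rightarrow> real \<Rightarrow> bool" where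
  "matching_fraction V r \<delta> c \<longleftrightarrow> (\<forall>E D. finite E \<longrightarrow> (\<forall>e\<in>E. finite (V e) \<and> card (V e) = r) \<longrightarrow> 0 < D \<longrightarrow>
     (\<forall>x. real (card {e\<in>E. x \<in> V e}) \<le> D) \<longrightarrow>
     (\<forall>x y. x \<noteq> y \<longrightarrow> real (card {e\<in>E. x \<in> V e \<and> y \<in> V e}) \<le> \<delta> * D) \<longrightarrow>
     (\<exists>M\<subseteq>E. matching_of V M \<and> c * real (card E) \<le> D * real (card M)))"

lemma matching_fractionD:
  assumes "matching_fraction V r \<delta> c" "finite E" "\<And>e. e \<in> E \<Longrightarrow> finite (V e)"
    and "\<And>e. e \<in> E \<Longrightarrow> card (V e) = r" "0 < D"
    and "\<And>x. real (card {e\<in>E. x \<in> V e}) \<le> D"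
    and "\<And>x y. x \<noteq> y \<Longrightarrow> real (card {e\<in>E. x \<in> V e \<and> y \<in> V e}) \<le> \<delta> * D"
  shows "\<exists>M\<subseteq>E. matching_of V M \<and> c * real (card E) \<le> D * real (card M)"
proof -
  have "\<forall>e\<in>E. finite (V e) \<and> card (V e) = r" using assms(3,4) by simp
  moreover have "\<forall>x. real (card {e\<in>E. x \<in> V e}) \<le> D" using assms(6) by (intro allI)
  moreover have "\<forall>x y. x \<noteq> y \<longrightarrow> real (card {e\<in>E. x \<in> V e \<and> y \<in> V e}) \<le> \<delta> * D"
    using assms(7) by (intro allI impI)
  ultimately show ?thesis
    using assms(1,2,5) unfolding matching_fraction_def by (elim allE[of _ E] allE[of _ D] impE)
qed

lemma matching_fraction_mono:
  assumes "matching_fraction V r \<delta> c" "c' \<le> c"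
  shows "matching_fraction V r \<delta> c'"
  unfolding matching_fraction_def
proof (intro allI impI)
  fix E D
  assume "finite E" "\<forall>e\<in>E. finite (V e) \<and> card (V e) = r" "0 < D"
    "\<forall>x. real (card {e\<in>E. x \<in> V e}) \<le> D"
    "\<forall>x y. x \<noteq> y \<longrightarrow> real (card {e\<in>E. x \<in> V e \<and> y \<in> V e}) \<le> \<delta> * D"
  then have "\<exists>M\<subseteq>E. matching_of V M \<and> c * real (card E) \<le> D * real (card M)"
    by (intro matching_fractionD[OF assms(1)]) auto
  moreover have "c' * real (card E) \<le> c * real (card E)" using assms(2) by (intro mult_right_mono) auto
  ultimately show "\<exists>M\<subseteq>E. matching_of V M \<and> c' * real (card E) \<le> D * real (card M)"
    by (meson order_trans)
qed

text \<open>
  The gain does not depend on \<open>c\<close>, so boundedly many steps lead from \<open>c = 0\<close> to \<open>1 - \<epsilon>\<close>.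
\<close>

lemma matching_fraction_step:
  fixes \<epsilon> :: real
  assumes r: "2 \<le> r" and \<epsilon>: "0 < \<epsilon>" "\<epsilon> \<le> 1" and c: "0 \<le> c" "c \<le> 1 - \<epsilon>"
    and \<delta>: "0 < \<delta>" "\<delta> * (9 * real r ^ 3 * 4 ^ r) \<le> (\<epsilon>\<^sup>2 / (16 * r)) ^ 3"
    and frac: "matching_fraction V r \<delta> c"
  shows "matching_fraction V r (\<delta> / 2 ^ r) (c + \<epsilon>\<^sup>2 / (8 * r))"
  unfolding matching_fraction_def
proof (intro allI impI)
  fix E D
  assume E: "finite E" "\<forall>e\<in>E. finite (V e) \<and> card (V e) = r" and D: "0 < D"
    and degD: "\<forall>x. real (card {e\<in>E. x \<in> V e}) \<le> D"
    and codegD: "\<forall>x y. x \<noteq> y \<longrightarrow> real (card {e\<in>E. x \<in> V e \<and> y \<in> V e}) \<le> \<delta> / 2 ^ r * D"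
  show "\<exists>M\<subseteq>E. matching_of V M \<and> (c + \<epsilon>\<^sup>2 / (8 * r)) * real (card E) \<le> D * real (card M)"
  proof (cases "E = {}")
    case True
    then show ?thesis by (auto simp: matching_of_def)
  next
    case False
    \<comment> \<open>For \<open>c \<le> 1 - \<epsilon>\<close> a round gains about
      \<open>\<theta> * (1 - r * \<theta>) - c * \<theta>\<close>, at least
      \<open>\<theta> * (\<epsilon> - r * \<theta>)\<close>. This is largest at the chosen
      \<open>\<theta>\<close>, where it equals \<open>4 * \<eta>\<close>. The degree slack and the
      trimming each cost at most \<open>\<eta>\<close>, which leaves \<open>2 * \<eta>\<close>, the
      claimed gain.\<close>
    define \<theta> where "\<theta> = \<epsilon> / (2 * r)"
    define \<eta> where "\<eta> = \<epsilon>\<^sup>2 / (16 * r)"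
    define n where "n = nat \<lfloor>D\<rfloor>"
    define p where "p = \<theta> / D"
    define d where "d = \<delta> / 2 ^ r * D"
    define q where "q = (1 - p) ^ n"
    define \<mu> where "\<mu> = D * q ^ (r - 1)"
    obtain e where e: "e \<in> E" using False by blast
    then have "V e \<noteq> {}" using E r by (metis card.empty not_numeral_le_zero)
    then obtain x where x: "x \<in> V e" by blast
    have "0 < card {e\<in>E. x \<in> V e}" using e x E by (auto simp: card_gt_0_iff)
    \<comment> \<open>An actual edge forces \<open>D\<close> to be at least 1; this makes
      \<open>p = \<theta> / D\<close> a probability.\<close>
    then have D1: "1 \<le> D" using degD[rule_format, of x] by linarith
    have n: "real n \<le> D" using D by (simp add: n_def)
    have r2: "2 \<le> real r" using r by simp
    have \<theta>: "0 < \<theta>" "\<theta> \<le> 1 / 4" using \<epsilon> r2 by (auto simp: \<theta>_def field_simps)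
    have \<eta>: "0 < \<eta>" "\<eta> \<le> 1" using \<epsilon> r2 power_le_one[of \<epsilon> 2] by (auto simp: \<eta>_def field_simps)
    have p: "0 \<le> p" "p \<le> 1" using \<theta> D1 by (auto simp: p_def field_simps)
    have pn: "p * n \<le> \<theta>" using n D \<theta> by (simp add: p_def field_simps)
    have "1 + real n * (- p) \<le> (1 + (- p)) ^ n" using p by (intro Bernoulli_inequality) auto
    then have q: "1 - \<theta> \<le> q" using pn by (simp add: q_def mult.commute)
    then have q0: "1 / 2 \<le> q" "0 < q" using \<theta> by auto
    have \<mu>: "0 < \<mu>" using D q0 by (simp add: \<mu>_def)
    have d0: "0 \<le> d" using \<delta> D by (simp add: d_def)
    \<comment> \<open>The degree bound shrinks by at most \<open>2 ^ r\<close> in a round while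
      codegrees do not grow. This is why the codegree ratio is tightened by exactly that
      factor.\<close>
    have half: "1 \<le> 2 ^ r * q ^ (r - 1)"
    proof -
      have "(1/2) ^ (r - 1) \<le> q ^ (r - 1)" using q0 by (intro power_mono) auto
      then have "2 ^ (r - 1) * (1/2) ^ (r - 1) \<le> 2 ^ r * q ^ (r - 1)"
        using q0 by (intro mult_mono power_increasing) auto
      then show ?thesis by (simp add: power_one_over)
    qed
    have \<delta>9: "\<delta> * (9 * real r ^ 3) \<le> \<eta> ^ 3"
    proof -
      have "\<delta> * (9 * real r ^ 3) * 1 \<le> \<delta> * (9 * real r ^ 3) * 4 ^ r"
        using \<delta> by (intro mult_left_mono) auto
      then show ?thesis using \<delta>(2) by (simp add: \<eta>_def mult.assoc)
    qed
    have small2: "2 * (p * (2 * real r)\<^sup>2 * d) \<le> 1"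
    proof -
      have "2 * (p * (2 * real r)\<^sup>2 * d) = 8 * \<theta> * (real r)\<^sup>2 * (\<delta> / 2 ^ r)"
        using D by (simp add: p_def d_def power_mult_distrib)
      also have "\<dots> \<le> 8 * (1/4) * (real r)\<^sup>2 * \<delta>"
        using \<theta> \<delta> by (intro mult_mono) (auto simp: field_simps)
      also have "\<dots> \<le> \<delta> * (9 * real r ^ 3)"
        using \<delta> r2 by (simp add: power2_eq_square power3_eq_cube)
      also have "\<dots> \<le> 1" using \<delta>9 \<eta> power_le_one[of \<eta> 3] by simp
      finally show ?thesis .
    qed
    interpret nibble E V r n p d
    proof
      show "card {e\<in>E. x \<in> V e} \<le> n" for x using degD D by (simp add: n_def le_nat_floor)
    qed (use E codegD p r d0 in \<open>auto simp: d_def\<close>)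
    let ?D' = "(1 + \<eta>) * \<mu>"
    have D': "0 < ?D'" using \<mu> \<eta> by simp
    \<comment> \<open>The weight \<open>c / ?D'\<close> is the number of matching edges that the
      hypothesis \<open>frac\<close> will extract per trimmed edge.\<close>
    have c': "0 \<le> c / ?D'" using c D' by simp
    have "p * real n \<le> 1" using pn \<theta> by simp
    note round = nibble_round[OF this small2 n \<eta>(1) _ c', folded q_def, folded \<mu>_def, OF \<mu>]
    then obtain S where S: "real (card E) * (p * q ^ r + c / ?D' * (q ^ r - (1 + \<eta>) / (\<eta>\<^sup>2 * \<mu>) * (9 * real r ^ 3 * d)))
        \<le> real (card (chosen S)) + c / ?D' * real (card (trimmed ?D' S))"
      by (elim exE)
    have sub: "trimmed ?D' S \<subseteq> surv S" "surv S \<subseteq> E" by (auto simp: trimmed_def surv_def)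
    have finT: "finite (trimmed ?D' S)" using E(1) finite_subset[OF order_trans[OF sub]] by simp
    have degT: "real (card {e\<in>trimmed ?D' S. x \<in> V e}) \<le> ?D'" for x
    proof (cases "{e\<in>trimmed ?D' S. x \<in> V e} = {}")
      case True
      then show ?thesis using D' by (simp only: card.empty)
    next
      case False
      then have "real (card {f\<in>surv S. x \<in> V f}) \<le> ?D'" by (auto simp: trimmed_def)
      moreover have "card {e\<in>trimmed ?D' S. x \<in> V e} \<le> card {f\<in>surv S. x \<in> V f}"
        using sub E finite_subset[OF sub(2)] by (intro card_mono) auto
      ultimately show ?thesis by linarith
    qed
    have codegT: "real (card {e\<in>trimmed ?D' S. x \<in> V e \<and> y \<in> V e}) \<le> \<delta> * ?D'" if "x \<noteq> y" for x y
    proof -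
      have "card {e\<in>trimmed ?D' S. x \<in> V e \<and> y \<in> V e} \<le> card {e\<in>E. x \<in> V e \<and> y \<in> V e}"
        using sub E by (intro card_mono) auto
      then have "real (card {e\<in>trimmed ?D' S. x \<in> V e \<and> y \<in> V e}) \<le> \<delta> / 2 ^ r * D"
        using codegD[rule_format, OF that] by linarith
      also have "\<dots> \<le> \<delta> / 2 ^ r * D * (2 ^ r * q ^ (r - 1))"
        using mult_left_mono[OF half, of "\<delta> / 2 ^ r * D"] \<delta> D by simp
      also have "\<dots> = \<delta> * \<mu>" by (simp add: \<mu>_def)
      also have "\<dots> \<le> \<delta> * ?D'" using \<delta> \<eta> \<mu> by (simp add: algebra_simps)
      finally show ?thesis .
    qed
    have "\<exists>M\<subseteq>trimmed ?D' S. matching_of V M \<and> c * real (card (trimmed ?D' S)) \<le> ?D' * real (card M)"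
      using sub E by (intro matching_fractionD[OF frac finT _ _ D' degT codegT]) auto
    then obtain M where M: "M \<subseteq> trimmed ?D' S" "matching_of V M" "c * real (card (trimmed ?D' S)) \<le> ?D' * real (card M)"
      by blast
    have finM: "finite M" "finite (chosen S)" using finite_subset[OF M(1) finT] E by (auto simp: chosen_def)
    have MS: "M \<subseteq> surv S" using M sub by blast
    have card_U: "real (card (chosen S \<union> M)) = real (card (chosen S)) + real (card M)"
      using matching_chosen(2)[OF MS M(2)] finM by (simp add: card_Un_disjoint)
    have "c / ?D' * real (card (trimmed ?D' S)) \<le> real (card M)"
      using M(3) D' by (simp add: field_simps)
    with S have main: "real (card E) * (p * q ^ r + c / ?D' * (q ^ r - (1 + \<eta>) / (\<eta>\<^sup>2 * \<mu>) * (9 * real r ^ 3 * d)))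
        \<le> real (card (chosen S \<union> M))"
      unfolding card_U by linarith
    have qr: "q ^ r = q * q ^ (r - 1)" using r by (simp flip: power_Suc)
    define X where "X = 9 * real r ^ 3 * (\<delta> / 2 ^ r) / (\<eta>\<^sup>2 * (q ^ (r - 1))\<^sup>2)"
    have eqX: "D * (p * q ^ r + c / ?D' * (q ^ r - (1 + \<eta>) / (\<eta>\<^sup>2 * \<mu>) * (9 * real r ^ 3 * d)))
        = \<theta> * q ^ r + c * (q / (1 + \<eta>)) - c * X"
    proof -
      have nz: "q ^ (r - 1) \<noteq> 0" "D \<noteq> 0" "1 + \<eta> \<noteq> 0" "\<eta> \<noteq> 0" using q0 D \<eta> by auto
      have "D * (c / ?D' * q ^ r) = c * (q / (1 + \<eta>))"
        using nz by (simp add: \<mu>_def qr)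
      moreover have "D * (c / ?D' * ((1 + \<eta>) / (\<eta>\<^sup>2 * \<mu>) * (9 * real r ^ 3 * d))) = c * X"
        using nz by (simp add: \<mu>_def X_def d_def power2_eq_square mult_ac)
      moreover have "D * (p * q ^ r) = \<theta> * q ^ r" using nz by (simp add: p_def)
      moreover have "D * (a + b * (y - z)) = D * a + D * (b * y) - D * (b * z)" for a b y z
        by (simp add: algebra_simps)
      ultimately show ?thesis by (simp only:)
    qed
    \<comment> \<open>\<open>X\<close> is the relative loss by trimming. The factor
      \<open>4 ^ r\<close> in the assumption on \<open>\<delta>\<close> pays for the square of
      \<open>q ^ (r - 1)\<close> in the denominator.\<close>
    have X: "X \<le> \<eta>"
    proof -
      have four: "(4::real) ^ r = 2 ^ r * 2 ^ r" by (simp flip: power_mult_distrib)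
      have \<delta>2: "\<delta> / 2 ^ r \<le> \<delta>" using \<delta> by (simp add: field_simps)
      have "(2 ^ r * q ^ (r - 1)) * (2 ^ r * q ^ (r - 1)) \<ge> 1"
        using half mult_mono[OF half half] by simp
      then have "1 \<le> 4 ^ r * (q ^ (r - 1))\<^sup>2"
        unfolding four by (simp add: power2_eq_square mult_ac)
      then have a: "1 / (q ^ (r - 1))\<^sup>2 \<le> 4 ^ r" using q0 by (simp add: field_simps)
      have "X = 9 * real r ^ 3 * (\<delta> / 2 ^ r) / \<eta>\<^sup>2 * (1 / (q ^ (r - 1))\<^sup>2)" by (simp add: X_def)
      also have "\<dots> \<le> 9 * real r ^ 3 * \<delta> / \<eta>\<^sup>2 * 4 ^ r"
        using \<delta> \<eta> by (intro mult_mono[OF _ a] divide_right_mono mult_left_mono \<delta>2) auto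
      also have "\<dots> = \<delta> * (9 * real r ^ 3 * 4 ^ r) / \<eta>\<^sup>2" by simp
      also have "\<dots> \<le> \<eta> ^ 3 / \<eta>\<^sup>2" using \<delta>(2) by (intro divide_right_mono) (auto simp: \<eta>_def)
      also have "\<dots> = \<eta>" using \<eta> by (simp add: power2_eq_square power3_eq_cube)
      finally show ?thesis .
    qed
    have gain: "c + \<epsilon>\<^sup>2 / (8 * r) \<le> \<theta> * q ^ r + c * (q / (1 + \<eta>)) - c * X"
    proof -
      have "1 + real r * (- \<theta>) \<le> (1 + (- \<theta>)) ^ r" using \<theta> by (intro Bernoulli_inequality) auto
      also have "\<dots> \<le> q ^ r" using q \<theta> by (intro power_mono) auto
      finally have "\<theta> * (1 - real r * \<theta>) \<le> \<theta> * q ^ r" using \<theta> by (intro mult_left_mono) auto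
      moreover have "real r * \<theta> = \<epsilon> / 2" using r2 by (simp add: \<theta>_def)
      ultimately have a: "\<theta> * (1 - \<epsilon> / 2) \<le> \<theta> * q ^ r" by simp
      have "(1 - \<eta>) * (1 + \<eta>) \<le> 1" by (simp add: algebra_simps)
      then have "1 - \<eta> \<le> 1 / (1 + \<eta>)" using \<eta> by (simp add: field_simps)
      then have "(1 - \<theta>) * (1 - \<eta>) \<le> q * (1 / (1 + \<eta>))"
        using q q0 \<eta> by (intro mult_mono) auto
      moreover have "1 - \<theta> - \<eta> \<le> (1 - \<theta>) * (1 - \<eta>)" using \<theta> \<eta> by (simp add: algebra_simps)
      ultimately have "c * (1 - \<theta> - \<eta>) \<le> c * (q / (1 + \<eta>))" using c by (intro mult_left_mono) auto
      moreover have "c * (1 - \<theta> - \<eta>) = c - c * \<theta> - c * \<eta>" by (simp add: algebra_simps)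
      moreover have "c * X \<le> c * \<eta>" using X c by (intro mult_left_mono)
      moreover have "c * \<theta> \<le> (1 - \<epsilon>) * \<theta>" using c \<theta> by (intro mult_right_mono) auto
      moreover have "c * \<eta> \<le> 1 * \<eta>" using c \<epsilon> \<eta> by (intro mult_right_mono) auto
      moreover have "\<theta> * (1 - \<epsilon> / 2) - (1 - \<epsilon>) * \<theta> = 4 * \<eta>"
        using r2 by (simp add: \<theta>_def \<eta>_def field_simps power2_eq_square)
      moreover have "\<epsilon>\<^sup>2 / (8 * r) = 2 * \<eta>" by (simp add: \<eta>_def)
      ultimately show ?thesis using a by linarith
    qed
    have "(c + \<epsilon>\<^sup>2 / (8 * r)) * real (card E)
        \<le> D * (p * q ^ r + c / ?D' * (q ^ r - (1 + \<eta>) / (\<eta>\<^sup>2 * \<mu>) * (9 * real r ^ 3 * d))) * real (card E)"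
      unfolding eqX using gain by (intro mult_right_mono) auto
    also have "\<dots> \<le> D * real (card (chosen S \<union> M))"
      using mult_left_mono[OF main, of D] D by (simp add: mult_ac)
    finally have "(c + \<epsilon>\<^sup>2 / (8 * r)) * real (card E) \<le> D * real (card (chosen S \<union> M))" .
    moreover have "chosen S \<union> M \<subseteq> E" using MS sub by (auto simp: chosen_def)
    ultimately show ?thesis using matching_chosen(1)[OF MS M(2)] by blast
  qed
qed

text \<open>\<open>\<delta>\<close> is fixed before \<open>V\<close>, so it may enter the choice of
  \<open>v0\<close>, which precedes the design.\<close>

lemma pippenger_matching:
  fixes \<epsilon> :: real
  assumes r: "2 \<le> r" and \<epsilon>: "0 < \<epsilon>"
  shows "\<exists>\<delta>>0. \<forall>V :: 'e \<Rightarrow> 'b set. matching_fraction V r \<delta> (1 - \<epsilon>)"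
proof -
  define \<epsilon>' where "\<epsilon>' = min \<epsilon> 1"
  have \<epsilon>': "0 < \<epsilon>'" "\<epsilon>' \<le> 1" "\<epsilon>' \<le> \<epsilon>" using \<epsilon> by (auto simp: \<epsilon>'_def)
  define g where "g = \<epsilon>'\<^sup>2 / (8 * r)"
  have g: "0 < g" using \<epsilon>' r by (simp add: g_def)
  \<comment> \<open>This meets the codegree condition of a step with equality; the smaller ratios
    reached later meet it a fortiori.\<close>
  define \<delta>0 where "\<delta>0 = (\<epsilon>'\<^sup>2 / (16 * r)) ^ 3 / (9 * real r ^ 3 * 4 ^ r)"
  have \<delta>0: "0 < \<delta>0" using \<epsilon>' r by (simp add: \<delta>0_def)
  have *: "matching_fraction V r (\<delta>0 / 2 ^ (r * i)) (min (i * g) (1 - \<epsilon>'))" for i and V :: "'e \<Rightarrow> 'b set"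
  proof (induction i)
    case 0
    have "min (real 0 * g) (1 - \<epsilon>') = 0" using \<epsilon>' by simp
    then show ?case
      by (auto simp: matching_fraction_def matching_of_def intro!: exI[of _ "{}"])
  next
    case (Suc i)
    have "\<delta>0 / 2 ^ (r * i) \<le> \<delta>0" using \<delta>0 by (simp add: field_simps)
    then have "\<delta>0 / 2 ^ (r * i) * (9 * real r ^ 3 * 4 ^ r) \<le> \<delta>0 * (9 * real r ^ 3 * 4 ^ r)"
      by (intro mult_right_mono) auto
    also have "\<dots> = (\<epsilon>'\<^sup>2 / (16 * r)) ^ 3" using r by (simp add: \<delta>0_def)
    finally have "matching_fraction V r (\<delta>0 / 2 ^ (r * i) / 2 ^ r) (min (i * g) (1 - \<epsilon>') + \<epsilon>'\<^sup>2 / (8 * r))"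
      using r \<epsilon>' g \<delta>0 by (intro matching_fraction_step[OF _ _ _ _ _ _ _ Suc]) auto
    moreover have "\<delta>0 / 2 ^ (r * i) / 2 ^ r = \<delta>0 / 2 ^ (r * Suc i)" by (simp add: power_add)
    moreover have "min (real (Suc i) * g) (1 - \<epsilon>') \<le> min (i * g) (1 - \<epsilon>') + \<epsilon>'\<^sup>2 / (8 * r)"
      using g unfolding g_def[symmetric] by (simp add: algebra_simps min_def)
    ultimately show ?case by (metis matching_fraction_mono)
  qed
  obtain i :: nat where "1 / g < i" using reals_Archimedean2 by blast
  then have "1 - \<epsilon>' \<le> i * g" using g \<epsilon>' by (simp add: field_simps)
  then have "min (i * g) (1 - \<epsilon>') = 1 - \<epsilon>'" by simp
  then have "matching_fraction V r (\<delta>0 / 2 ^ (r * i)) (1 - \<epsilon>)" for V :: "'e \<Rightarrow> 'b set"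
    using *[of V i] \<epsilon>' by (auto intro: matching_fraction_mono)
  then show ?thesis using \<delta>0 by (intro exI[of _ "\<delta>0 / 2 ^ (r * i)"]) auto
qed

subsection \<open>Designs partitioned into orbits\<close>

text \<open>What the probabilistic part has to know about a cyclic design. The group action is
  distilled into bounds: an orbit covers each point at most \<open>k\<close> times, has between
  \<open>v / k\<close> and \<open>v\<close> blocks, and all but \<open>K\<close> orbits are
  full.\<close>

locale block_system =
  fixes V :: "'a set" and C :: "'c set" and blk :: "'c \<Rightarrow> 'a set" and Orb :: "'c set set"
    and v k l K :: nat
  assumes finV: "finite V" and cardV: "card V = v" and finC: "finite C"
    and blk_sub: "\<And>c. c \<in> C \<Longrightarrow> blk c \<subseteq> V" and card_blk: "\<And>c. c \<in> C \<Longrightarrow> card (blk c) = k"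
    and Union_Orb: "\<Union>Orb = C"
    and Orb_disjoint: "\<And>o1 o2 c. o1 \<in> Orb \<Longrightarrow> o2 \<in> Orb \<Longrightarrow> c \<in> o1 \<Longrightarrow> c \<in> o2 \<Longrightarrow> o1 = o2"
    and through: "\<And>ob x. ob \<in> Orb \<Longrightarrow> card {c\<in>ob. x \<in> blk c} \<le> k"
    and large: "\<And>ob. ob \<in> Orb \<Longrightarrow> v \<le> k * card ob"
    and card_Orb_le: "\<And>ob. ob \<in> Orb \<Longrightarrow> card ob \<le> v"
    and short: "card {ob\<in>Orb. card ob \<noteq> v} \<le> K"
    and degree: "\<And>x. x \<in> V \<Longrightarrow> (k - 1) * card {c\<in>C. x \<in> blk c} = l * (v - 1)"
    and pair: "\<And>x y. x \<in> V \<Longrightarrow> y \<in> V \<Longrightarrow> x \<noteq> y \<Longrightarrow> card {c\<in>C. x \<in> blk c \<and> y \<in> blk c} = l"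
    and k: "2 \<le> k"
begin

section \<open>Counting blocks and orbits\<close>

lemma Orb_sub: "ob \<in> Orb \<Longrightarrow> ob \<subseteq> C"
  using Union_Orb by blast

lemma finite_orbits: "finite Orb" "ob \<in> Orb \<Longrightarrow> finite ob"
proof -
  have "Orb \<subseteq> Pow C" using Orb_sub by blast
  moreover have "finite (Pow C)" using finC by simp
  ultimately show "finite Orb" by (rule finite_subset)
  show "ob \<in> Orb \<Longrightarrow> finite ob" using Orb_sub finC by (rule finite_subset)
qed

lemma finite_blk: "c \<in> C \<Longrightarrow> finite (blk c)"
  using blk_sub finV by (rule finite_subset)

lemma blk_nonempty: "c \<in> C \<Longrightarrow> blk c \<noteq> {}"
  using card_blk[of c] k by auto

lemma sum_card_orbits:
  assumes "G \<subseteq> Orb" "P \<subseteq> \<Union>G"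
  shows "(\<Sum>ob\<in>G. card (P \<inter> ob)) = card P"
proof -
  have fin: "finite G" using assms(1) finite_orbits(1) by (rule finite_subset)
  have "P = (\<Union>ob\<in>G. P \<inter> ob)" using assms(2) by blast
  also have "card \<dots> = (\<Sum>ob\<in>G. card (P \<inter> ob))"
  proof (rule card_UN_disjoint[OF fin])
    show "\<forall>i\<in>G. finite (P \<inter> i)" using finite_orbits(2) assms(1) by blast
    show "\<forall>i\<in>G. \<forall>j\<in>G. i \<noteq> j \<longrightarrow> P \<inter> i \<inter> (P \<inter> j) = {}"
      using Orb_disjoint assms(1) by blast
  qed
  finally show ?thesis ..
qed

lemma sum_degrees: "(\<Sum>x\<in>V. card {c\<in>C. x \<in> blk c}) = k * card C"
proof -
  have "(\<Sum>x\<in>V. card {c\<in>C. x \<in> blk c}) = (\<Sum>c\<in>C. card {x\<in>V. x \<in> blk c})"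
    using finV finC by (intro sum_multicount_gen) auto
  also have "\<dots> = (\<Sum>c\<in>C. k)"
  proof (rule sum.cong[OF refl])
    fix c assume c: "c \<in> C"
    then have "{x\<in>V. x \<in> blk c} = blk c" using blk_sub by blast
    then show "card {x\<in>V. x \<in> blk c} = k" using card_blk[OF c] by simp
  qed
  finally show ?thesis by (simp add: mult.commute)
qed

lemma card_C: "k * (k - 1) * card C = l * v * (v - 1)"
proof -
  have "(k - 1) * (k * card C) = (\<Sum>x\<in>V. (k - 1) * card {c\<in>C. x \<in> blk c})"
    by (simp only: sum_degrees flip: sum_distrib_left)
  also have "\<dots> = v * (l * (v - 1))"
    by (simp add: degree[simplified] cardV)
  finally show ?thesis by (simp add: mult_ac)
qed

lemma card_Orb_sum: "(\<Sum>ob\<in>Orb. card ob) = card C"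
proof -
  have "(\<Sum>ob\<in>Orb. card ob) = (\<Sum>ob\<in>Orb. card (C \<inter> ob))"
    using Orb_sub by (intro sum.cong) (auto simp: Int_absorb1)
  then show ?thesis using sum_card_orbits[of Orb C] Union_Orb by simp
qed

lemma card_C_le: "card C \<le> l * v * v"
proof -
  have "card C * 1 \<le> card C * (k * (k - 1))" using k by (intro mult_le_mono) auto
  also have "\<dots> = l * v * (v - 1)" using card_C by (simp add: mult_ac)
  also have "\<dots> \<le> l * v * v" by (intro mult_le_mono) auto
  finally show ?thesis by simp
qed

text \<open>Bounds the number of blocks missing after the first matching by a small multiple of
  \<open>v\<close>.\<close>

lemma card_Orb_upper: "0 < v \<Longrightarrow> card Orb \<le> l * v"
proof -
  assume v: "0 < v"
  have "(\<Sum>ob\<in>Orb. v) \<le> (\<Sum>ob\<in>Orb. k * card ob)" by (intro sum_mono large)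
  then have "card Orb * v \<le> k * card C" by (simp add: card_Orb_sum flip: sum_distrib_left)
  then have "card Orb * v * (k - 1) \<le> k * card C * (k - 1)" by (rule mult_le_mono1)
  also have "\<dots> = l * (v - 1) * v" using card_C by (simp add: mult_ac)
  finally have "card Orb * (k - 1) * v \<le> l * (v - 1) * v" by (simp add: mult_ac)
  then have "card Orb * (k - 1) \<le> l * (v - 1)" using v by simp
  moreover have "card Orb * 1 \<le> card Orb * (k - 1)" using k by (intro mult_le_mono) auto
  moreover have "l * (v - 1) \<le> l * v" by simp
  ultimately show ?thesis by linarith
qed

text \<open>The number of orbits grows linearly with \<open>v\<close>, so boundedly many exceptional
  orbits are a negligible fraction.\<close>

lemma card_Orb_lower: "0 < v \<Longrightarrow> l * (v - 1) \<le> k * (k - 1) * card Orb"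
proof -
  assume v: "0 < v"
  have "(\<Sum>ob\<in>Orb. card ob) \<le> (\<Sum>ob\<in>Orb. v)" by (intro sum_mono card_Orb_le)
  then have "card C \<le> card Orb * v" by (simp add: card_Orb_sum)
  then have "k * (k - 1) * card C \<le> k * (k - 1) * (card Orb * v)" by (intro mult_le_mono) auto
  then have "l * (v - 1) * v \<le> k * (k - 1) * card Orb * v" unfolding card_C by (simp add: mult_ac)
  then show ?thesis using v by simp
qed

lemma card_meeting:
  assumes "ob \<in> Orb" "finite Z"
  shows "card {c\<in>ob. blk c \<inter> Z \<noteq> {}} \<le> k * card Z"
proof -
  have "{c\<in>ob. blk c \<inter> Z \<noteq> {}} = (\<Union>x\<in>Z. {c\<in>ob. x \<in> blk c})" by blast
  then have "card {c\<in>ob. blk c \<inter> Z \<noteq> {}} \<le> (\<Sum>x\<in>Z. card {c\<in>ob. x \<in> blk c})"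
    using card_UN_le[OF assms(2), of "\<lambda>x. {c\<in>ob. x \<in> blk c}"] by simp
  also have "\<dots> \<le> (\<Sum>x\<in>Z. k)" by (intro sum_mono through assms)
  finally show ?thesis by (simp add: mult.commute)
qed

lemma card_inside_minus:
  assumes "ob \<in> Orb" "finite Z"
  shows "card {c\<in>ob. blk c \<subseteq> W} \<le> card {c\<in>ob. blk c \<subseteq> W - Z} + k * card Z"
proof -
  have "{c\<in>ob. blk c \<subseteq> W} \<subseteq> {c\<in>ob. blk c \<subseteq> W - Z} \<union> {c\<in>ob. blk c \<inter> Z \<noteq> {}}" by blast
  then have "card {c\<in>ob. blk c \<subseteq> W} \<le> card ({c\<in>ob. blk c \<subseteq> W - Z} \<union> {c\<in>ob. blk c \<inter> Z \<noteq> {}})"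
    using finite_orbits(2)[OF assms(1)] by (intro card_mono) auto
  also have "\<dots> \<le> card {c\<in>ob. blk c \<subseteq> W - Z} + card {c\<in>ob. blk c \<inter> Z \<noteq> {}}" by (rule card_Un_le)
  finally show ?thesis using card_meeting[OF assms] by linarith
qed

lemma card_points_le:
  assumes "P \<subseteq> C"
  shows "card (\<Union>(blk ` P)) \<le> k * card P"
proof -
  have "card (\<Union>(blk ` P)) \<le> (\<Sum>c\<in>P. card (blk c))"
    using finite_subset[OF assms finC] by (rule card_UN_le)
  also have "\<dots> = (\<Sum>c\<in>P. k)" using card_blk assms by (intro sum.cong) auto
  finally show ?thesis by (simp add: mult.commute)
qed

text \<open>Each forbidden or already covered point spoils at most \<open>k\<close> blocks of an
  orbit, and a placed block covers \<open>k\<close> points. The induction is on the total demand: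
  one unit is removed from \<open>o1\<close>, the rest is placed, then a block of \<open>o1\<close>
  is added.\<close>

lemma greedy:
  assumes G: "G \<subseteq> Orb" and Z: "finite Z"
    and room: "\<And>ob. ob \<in> G \<Longrightarrow> 0 < f ob \<Longrightarrow> k * (card Z + k * sum f G) \<le> card {c\<in>ob. blk c \<subseteq> W}"
  shows "\<exists>P\<subseteq>\<Union>G. matching_of blk P \<and> (\<forall>c\<in>P. blk c \<subseteq> W - Z) \<and> (\<forall>ob\<in>G. card (P \<inter> ob) = f ob)"
  using room
proof (induction "sum f G" arbitrary: f)
  case 0
  have "finite G" using G finite_orbits(1) by (rule finite_subset)
  then have "\<forall>ob\<in>G. f ob = 0" using 0(1) by simp
  then show ?case by (intro exI[of _ "{}"]) (auto simp: matching_of_def)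
next
  case (Suc n)
  have finG: "finite G" using G finite_orbits(1) by (rule finite_subset)
  from Suc(2) have "sum f G \<noteq> 0" by simp
  then obtain o1 where o1: "o1 \<in> G" "0 < f o1" using finG by auto
  then have o1O: "o1 \<in> Orb" using G by blast
  define f' where "f' = f(o1 := f o1 - 1)"
  have "sum f G = f o1 + sum f (G - {o1})" using finG o1 by (simp add: sum.remove)
  moreover have "sum f' G = f' o1 + sum f' (G - {o1})" using finG o1 by (simp add: sum.remove)
  moreover have "sum f' (G - {o1}) = sum f (G - {o1})" by (intro sum.cong) (auto simp: f'_def)
  ultimately have n: "n = sum f' G" using Suc(2) o1 by (simp add: f'_def)
  have room': "k * (card Z + k * sum f' G) \<le> card {c\<in>ob. blk c \<subseteq> W}" if "ob \<in> G" "0 < f' ob" for ob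
  proof -
    have "0 < f ob" using that by (auto simp: f'_def split: if_splits)
    then have "k * (card Z + k * sum f G) \<le> card {c\<in>ob. blk c \<subseteq> W}" using Suc(3) that by blast
    moreover have "k * (card Z + k * sum f' G) \<le> k * (card Z + k * sum f G)"
      using n Suc(2) by (intro mult_le_mono add_le_mono) auto
    ultimately show ?thesis by linarith
  qed
  obtain P where P: "P \<subseteq> \<Union>G" "matching_of blk P" "\<forall>c\<in>P. blk c \<subseteq> W - Z" "\<forall>ob\<in>G. card (P \<inter> ob) = f' ob"
    using Suc(1)[OF n room'] by blast
  have PC: "P \<subseteq> C" using P(1) G Union_Orb by blast
  have "card P = n" using sum_card_orbits[OF G P(1)] P(4) n by simp
  then have used: "card (\<Union>(blk ` P)) \<le> k * n" using card_points_le[OF PC] by simp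
  have finU: "finite (Z \<union> \<Union>(blk ` P))"
    using Z finite_subset[OF PC finC] finite_blk PC by auto
  have "card (Z \<union> \<Union>(blk ` P)) \<le> card Z + k * n"
    using card_Un_le[of Z "\<Union>(blk ` P)"] used by linarith
  then have "k * card (Z \<union> \<Union>(blk ` P)) \<le> k * (card Z + k * n)" by (intro mult_le_mono) auto
  \<comment> \<open>The recursive \<open>P\<close> has one block fewer than demanded; this
    strictness leaves a free block although \<open>room\<close> is a weak inequality.\<close>
  also have "\<dots> < k * (card Z + k * sum f G)" using k unfolding Suc(2)[symmetric] by simp
  also have "\<dots> \<le> card {c\<in>o1. blk c \<subseteq> W}" by (rule Suc(3)[OF o1])
  also have "\<dots> \<le> card {c\<in>o1. blk c \<subseteq> W - (Z \<union> \<Union>(blk ` P))} + k * card (Z \<union> \<Union>(blk ` P))"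
    by (rule card_inside_minus[OF o1O finU])
  finally have "card {c\<in>o1. blk c \<subseteq> W - (Z \<union> \<Union>(blk ` P))} \<noteq> 0" by linarith
  then have "{c\<in>o1. blk c \<subseteq> W - (Z \<union> \<Union>(blk ` P))} \<noteq> {}" by (metis card.empty)
  then obtain c where c: "c \<in> o1" "blk c \<subseteq> W - (Z \<union> \<Union>(blk ` P))" by blast
  have cC: "c \<in> C" using c o1O Orb_sub by blast
  have new: "disjnt (blk c) (blk e)" if "e \<in> P" for e using c(2) that by (auto simp: disjnt_def)
  have cP: "c \<notin> P" using new[of c] blk_nonempty[OF cC] by (auto simp: disjnt_def)
  show ?case
  proof (intro exI[of _ "insert c P"] conjI)
    show "insert c P \<subseteq> \<Union>G" using P(1) c o1 by blast
    show "matching_of blk (insert c P)"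
      using P(2) new disjnt_sym[OF new] by (auto simp: matching_of_def pairwise_insert)
    show "\<forall>c\<in>insert c P. blk c \<subseteq> W - Z" using P(3) c(2) by blast
    show "\<forall>ob\<in>G. card (insert c P \<inter> ob) = f ob"
    proof
      fix ob assume ob: "ob \<in> G"
      show "card (insert c P \<inter> ob) = f ob"
      proof (cases "ob = o1")
        case True
        then have "insert c P \<inter> ob = insert c (P \<inter> ob)" using c by blast
        moreover have "finite (P \<inter> ob)" using finite_subset[OF PC finC] by blast
        ultimately have "card (insert c P \<inter> ob) = Suc (card (P \<inter> ob))" using cP by simp
        then show ?thesis using P(4) ob True o1 by (simp add: f'_def)
      next
        case False
        then have "c \<notin> ob" using Orb_disjoint[of ob o1 c] ob G o1O c by blast
        then have "insert c P \<inter> ob = P \<inter> ob" by blast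
        then show ?thesis using P(4) ob False by (simp add: f'_def)
      qed
    qed
  qed
qed

text \<open>
  The orbits become extra vertices, with \<open>m\<close> copies each, of a hypergraph on the points of \<open>W\<close>:
  a matching then uses every orbit at most \<open>m\<close> times.
\<close>

lemma matching_in_region:
  fixes e \<delta> Q :: real
  assumes frac: "\<And>H :: 'c set \<times> 'c \<times> nat \<Rightarrow> ('a + 'c set \<times> nat) set. matching_fraction H (k + 1) \<delta> (1 - e / 4)"
    and e: "0 < e" "e \<le> 1" and Q: "0 < Q" and W: "W \<subseteq> V" and G: "G \<subseteq> Orb" and \<delta>: "0 < \<delta>"
    and pts: "\<And>x. x \<in> W \<Longrightarrow> real m * real (card {c\<in>C. x \<in> blk c \<and> blk c - {x} \<subseteq> W}) \<le> (1 + e / 4) * Q"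
    and upper: "\<And>ob. ob \<in> G \<Longrightarrow> real (card {c\<in>ob. blk c \<subseteq> W}) \<le> (1 + e / 4) * Q"
    and lower: "\<And>ob. ob \<in> G \<Longrightarrow> (1 - e / 4) * Q \<le> real (card {c\<in>ob. blk c \<subseteq> W})"
    and codeg: "real (l * m + k) \<le> \<delta> * Q"
  shows "\<exists>P\<subseteq>\<Union>G. matching_of blk P \<and> (\<forall>c\<in>P. blk c \<subseteq> W) \<and> (\<forall>ob\<in>G. card (P \<inter> ob) \<le> m)
     \<and> (1 - e) * (real m * real (card G)) \<le> real (card P)"
proof -
  define H :: "'c set \<times> 'c \<times> nat \<Rightarrow> ('a + 'c set \<times> nat) set"
    where "H = (\<lambda>(ob, c, i). insert (Inr (ob, i)) (Inl ` blk c))"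
  define E where "E = Sigma G (\<lambda>ob. {c\<in>ob. blk c \<subseteq> W} \<times> {..<m})"
  define D where "D = (1 + e / 4) * Q"
  have D: "0 < D" using e Q by (simp add: D_def)
  have finG: "finite G" using G finite_orbits(1) by (rule finite_subset)
  have fino: "finite ob" if "ob \<in> G" for ob using that G finite_orbits(2) by blast
  have finE: "finite E" using finG fino by (auto simp: E_def intro!: finite_SigmaI)
  have EC: "c \<in> C" "ob \<in> Orb" "c \<in> ob" "blk c \<subseteq> W" "i < m" "ob \<in> G" if "(ob, c, i) \<in> E" for ob c i
    using that G Orb_sub by (auto simp: E_def)
  have Hfin: "finite (H x)" "card (H x) = k + 1" if "x \<in> E" for x
  proof -
    obtain ob c i where x: "x = (ob, c, i)" by (cases x)
    have cC: "c \<in> C" using that EC unfolding x by blast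
    have Hx: "H x = insert (Inr (ob, i)) (Inl ` blk c)" by (simp add: H_def x)
    show "finite (H x)" unfolding Hx using finite_blk[OF cC] by simp
    show "card (H x) = k + 1" unfolding Hx using finite_blk[OF cC] card_blk[OF cC]
      by (subst card_insert_disjoint) (auto simp: card_image)
  qed
  have inH: "Inl x \<in> H (ob, c, i) \<longleftrightarrow> x \<in> blk c" "Inr (o', j) \<in> H (ob, c, i) \<longleftrightarrow> o' = ob \<and> j = i" for x ob c i o' j
    by (auto simp: H_def)
  \<comment> \<open>Orbits are disjoint, so an edge is determined by its block and its copy
    number.\<close>
  have proj: "card F \<le> card A * m" if "F \<subseteq> E" "\<And>ob c i. (ob, c, i) \<in> F \<Longrightarrow> c \<in> A" "finite A" for F A
  proof -
    have inj: "inj_on snd F"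
    proof (rule inj_onI)
      fix y z assume yz: "y \<in> F" "z \<in> F" "snd y = snd z"
      obtain ob ob' c i where eq: "y = (ob, c, i)" "z = (ob', c, i)"
        using yz(3) by (metis prod.collapse)
      then have "(ob, c, i) \<in> E" "(ob', c, i) \<in> E" using yz that(1) by auto
      then have "ob = ob'" using Orb_disjoint[OF EC(2) EC(2) EC(3) EC(3)] by simp
      then show "y = z" using eq by simp
    qed
    have "snd ` F \<subseteq> A \<times> {..<m}" using that(1,2) EC(5) by fastforce
    then have "card (snd ` F) \<le> card (A \<times> {..<m})" using that(3) by (intro card_mono) auto
    then show ?thesis by (simp add: card_image[OF inj] card_cartesian_product)
  qed
  have degH: "real (card {y\<in>E. u \<in> H y}) \<le> D" for u
  proof (cases u)
    case (Inl x)
    show ?thesis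
    proof (cases "x \<in> W")
      case True
      have "card {y\<in>E. u \<in> H y} \<le> card {c\<in>C. x \<in> blk c \<and> blk c - {x} \<subseteq> W} * m"
        using finC by (intro proj) (auto simp: Inl inH dest: EC(1) subsetD[OF EC(4)])
      then have "real (card {y\<in>E. u \<in> H y}) \<le> real m * real (card {c\<in>C. x \<in> blk c \<and> blk c - {x} \<subseteq> W})"
        by (simp add: mult.commute flip: of_nat_mult)
      then show ?thesis using pts[OF True] by (simp add: D_def)
    next
      case False
      then have "{y\<in>E. u \<in> H y} = {}" using EC(4) by (auto simp: Inl inH)
      then show ?thesis using D by (simp only: card.empty)
    qed
  next
    case (Inr y)
    obtain ob i where y: "y = (ob, i)" by (cases y)
    show ?thesis
    proof (cases "ob \<in> G")
      case True
      have "{y\<in>E. u \<in> H y} \<subseteq> (\<lambda>c. (ob, c, i)) ` {c\<in>ob. blk c \<subseteq> W}"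
        by (auto simp: Inr y inH E_def)
      then have "card {y\<in>E. u \<in> H y} \<le> card {c\<in>ob. blk c \<subseteq> W}"
        using fino[OF True] by (intro surj_card_le) auto
      then show ?thesis using upper[OF True] by (simp add: D_def)
    next
      case False
      then have "{y\<in>E. u \<in> H y} = {}" using EC(6) by (auto simp: Inr y inH)
      then show ?thesis using D by (simp only: card.empty)
    qed
  qed
  have "\<delta> * Q \<le> \<delta> * D" using \<delta> Q e by (simp add: D_def algebra_simps)
  then have codeg': "real (l * m + k) \<le> \<delta> * D" using codeg by linarith
  have mixed: "card {y\<in>E. Inl x \<in> H y \<and> Inr z \<in> H y} \<le> l * m + k" for x z
  proof -
    obtain ob i where z: "z = (ob, i)" by (cases z)
    show ?thesis
    proof (cases "ob \<in> G")
      case True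
      have "{y\<in>E. Inl x \<in> H y \<and> Inr z \<in> H y} \<subseteq> (\<lambda>c. (ob, c, i)) ` {c\<in>ob. x \<in> blk c}"
        by (auto simp: z inH E_def)
      then have "card {y\<in>E. Inl x \<in> H y \<and> Inr z \<in> H y} \<le> card {c\<in>ob. x \<in> blk c}"
        using fino[OF True] by (intro surj_card_le) auto
      then show ?thesis using through[of ob x] True G by fastforce
    next
      case False
      then have "{y\<in>E. Inl x \<in> H y \<and> Inr z \<in> H y} = {}" using EC(6) by (auto simp: z inH)
      then show ?thesis by (simp only: card.empty)
    qed
  qed
  have codegH: "real (card {y\<in>E. u \<in> H y \<and> w \<in> H y}) \<le> \<delta> * D" if uw: "u \<noteq> w" for u w
  proof -
    have "card {y\<in>E. u \<in> H y \<and> w \<in> H y} \<le> l * m + k"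
    proof (cases u)
      case (Inl x)
      show ?thesis
      proof (cases w)
        case (Inl y)
        have "card {z\<in>E. u \<in> H z \<and> w \<in> H z} \<le> card {c\<in>C. x \<in> blk c \<and> y \<in> blk c} * m"
          using finC EC(1) by (intro proj) (auto simp: \<open>u = Inl x\<close> Inl inH)
        moreover have "card {c\<in>C. x \<in> blk c \<and> y \<in> blk c} \<le> l"
        proof (cases "x \<in> V \<and> y \<in> V")
          case True
          then show ?thesis using pair[of x y] uw \<open>u = Inl x\<close> Inl by simp
        next
          case False
          then have "{c\<in>C. x \<in> blk c \<and> y \<in> blk c} = {}" using blk_sub by blast
          then show ?thesis by (simp only: card.empty)
        qed
        then have "card {c\<in>C. x \<in> blk c \<and> y \<in> blk c} * m \<le> l * m" by (rule mult_le_mono1)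
        ultimately show ?thesis by linarith
      next
        case (Inr z)
        then show ?thesis using mixed[of x z] \<open>u = Inl x\<close> by simp
      qed
    next
      case (Inr z)
      show ?thesis
      proof (cases w)
        case (Inl y)
        then show ?thesis using mixed[of y z] \<open>u = Inr z\<close> by (simp add: conj_commute)
      next
        case (Inr z')
        then have "{y\<in>E. u \<in> H y \<and> w \<in> H y} = {}"
          using uw \<open>u = Inr z\<close> by (cases z; cases z') (auto simp: inH)
        then show ?thesis by (simp only: card.empty)
      qed
    qed
    then have "real (card {y\<in>E. u \<in> H y \<and> w \<in> H y}) \<le> real (l * m + k)" by (simp only: of_nat_le_iff)
    then show ?thesis using codeg' by linarith
  qed
  obtain M where M: "M \<subseteq> E" "matching_of H M" "(1 - e / 4) * real (card E) \<le> D * real (card M)"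
    using matching_fractionD[OF frac finE Hfin D degH codegH] by blast
  define P where "P = (\<lambda>y. fst (snd y)) ` M"
  have finM: "finite M" using M(1) finE by (rule finite_subset)
  have disj: "disjnt (H y) (H z)" if "y \<in> M" "z \<in> M" "y \<noteq> z" for y z
    using M(2) that by (auto simp: matching_of_def pairwise_def)
  have disjb: "disjnt (blk c) (blk c')" if "(ob, c, i) \<in> M" "(ob', c', i') \<in> M" "(ob, c, i) \<noteq> (ob', c', i')"
    for ob c i ob' c' i'
    using disj[OF that] by (auto simp: disjnt_def H_def)
  \<comment> \<open>One block cannot be matched to two copies of its orbit, since those edges would
    share the points of the nonempty block.\<close>
  have injM: "inj_on (\<lambda>y. fst (snd y)) M"
  proof (rule inj_onI)
    fix y z assume yz: "y \<in> M" "z \<in> M" "fst (snd y) = fst (snd z)"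
    obtain ob c i ob' c' i' where eq: "y = (ob, c, i)" "z = (ob', c', i')" by (metis prod_cases3)
    have "c = c'" using yz(3) eq by simp
    moreover have "blk c \<noteq> {}" using EC(1)[of ob c i] yz(1) M(1) eq blk_nonempty by blast
    ultimately show "y = z" using disjb[of ob c i ob' c' i'] yz eq by (auto simp: disjnt_def)
  qed
  have PE: "\<exists>ob i. (ob, c, i) \<in> M" if "c \<in> P" for c
  proof -
    obtain y where "y \<in> M" "c = fst (snd y)" using \<open>c \<in> P\<close> unfolding P_def by (elim imageE)
    then have "(fst y, c, snd (snd y)) \<in> M" by simp
    then show ?thesis by (intro exI)
  qed
  have "matching_of blk P" unfolding matching_of_def pairwise_def
  proof (intro ballI impI)
    fix c c' assume "c \<in> P" "c' \<in> P" "c \<noteq> c'"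
    then show "disjnt (blk c) (blk c')" using PE disjb by (metis Pair_inject)
  qed
  moreover have "P \<subseteq> \<Union>G" using PE M(1) EC(3,6) by blast
  moreover have "\<forall>c\<in>P. blk c \<subseteq> W" using PE M(1) EC(4) by blast
  moreover have "card (P \<inter> ob) \<le> m" if ob: "ob \<in> G" for ob
  proof -
    let ?F = "{y\<in>M. fst y = ob}"
    have "P \<inter> ob \<subseteq> (\<lambda>y. fst (snd y)) ` ?F"
    proof
      fix c assume c: "c \<in> P \<inter> ob"
      then obtain ob' i where oi: "(ob', c, i) \<in> M" using PE by blast
      then have "ob' = ob" using Orb_disjoint[of ob' ob c] EC(2,3)[of ob' c i] M(1) ob G c by blast
      then show "c \<in> (\<lambda>y. fst (snd y)) ` ?F" using oi by force
    qed
    then have "card (P \<inter> ob) \<le> card ?F" using finM by (intro surj_card_le) auto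
    also have "\<dots> = card ((\<lambda>y. snd (snd y)) ` ?F)"
    proof (rule card_image[symmetric], rule inj_onI)
      fix y z assume yz: "y \<in> ?F" "z \<in> ?F" "snd (snd y) = snd (snd z)"
      obtain c i c' where eq: "y = (ob, c, i)" "z = (ob, c', i)"
        using yz by (metis (mono_tags, lifting) mem_Collect_eq prod.collapse)
      then have "Inr (ob, i) \<in> H y \<inter> H z" by (simp add: inH)
      then show "y = z" using disj[of y z] yz by (auto simp: disjnt_def)
    qed
    also have "\<dots> \<le> card {..<m}" using M(1) EC(5) by (intro card_mono) fastforce+
    finally show ?thesis by simp
  qed
  moreover have "(1 - e) * (real m * real (card G)) \<le> real (card P)"
  proof -
    have "card P = card M" unfolding P_def by (rule card_image[OF injM])
    have "card E = (\<Sum>ob\<in>G. card {c\<in>ob. blk c \<subseteq> W} * m)"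
      unfolding E_def using finG fino by (subst card_SigmaI) auto
    then have "real (card E) = (\<Sum>ob\<in>G. real (card {c\<in>ob. blk c \<subseteq> W}) * real m)" by simp
    also have "\<dots> \<ge> (\<Sum>ob\<in>G. (1 - e / 4) * Q * real m)"
      using lower by (intro sum_mono mult_right_mono) auto
    finally have cE: "(1 - e / 4) * Q * (real m * real (card G)) \<le> real (card E)" by (simp add: mult_ac)
    \<comment> \<open>Three losses of \<open>e / 4\<close> (upper slack in \<open>D\<close>, lower
      slack in the orbit sizes, imperfect matching) fit into a single \<open>e\<close>.\<close>
    have "(1 - e) * (1 + e / 4) \<le> (1 - e / 4) * (1 - e / 4)" using e by (simp add: algebra_simps)
    then have "((1 - e) * (1 + e / 4)) * (Q * (real m * real (card G)))
        \<le> ((1 - e / 4) * (1 - e / 4)) * (Q * (real m * real (card G)))"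
      using Q by (intro mult_right_mono) auto
    also have "\<dots> \<le> (1 - e / 4) * real (card E)"
      using mult_left_mono[OF cE, of "1 - e / 4"] e by (simp add: mult_ac)
    also have "\<dots> \<le> D * real (card P)" using M(3) \<open>card P = card M\<close> by simp
    finally have "D * ((1 - e) * (real m * real (card G))) \<le> D * real (card P)"
      by (simp add: D_def mult_ac)
    then show ?thesis using D by simp
  qed
  ultimately show ?thesis by (intro exI[of _ P]) auto
qed

section \<open>Concentration for a random set of points\<close>

definition inside :: "'a set \<Rightarrow> 'c set \<Rightarrow> real" where
  "inside W ob = real (card {c\<in>ob. blk c \<subseteq> W})"

text \<open>\<open>x\<close> itself need not lie in \<open>W\<close>: the count depends only on the
  other points, so it concentrates for every point, with exponent \<open>k - 1\<close>.\<close>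

definition around :: "'a set \<Rightarrow> 'a \<Rightarrow> real" where
  "around W x = real (card {c\<in>C. x \<in> blk c \<and> blk c - {x} \<subseteq> W})"

definition pdeg :: "'a \<Rightarrow> real" where
  "pdeg x = real (card {c\<in>C. x \<in> blk c})"

lemma sum_pdeg: "(\<Sum>x\<in>V. pdeg x) = real k * real (card C)"
  by (simp add: pdeg_def sum_degrees flip: of_nat_sum)

lemma expect_subset:
  assumes "T \<subseteq> V"
  shows "subset_expect p V (\<lambda>S. of_bool (T \<subseteq> S)) = p ^ card T"
  using subset_expect_event[OF finV assms, of "{}" p] by simp

text \<open>Disjoint blocks lie in the random set independently, hence \<open>\<tau> = 0\<close>,
  and a block meets at most \<open>k * k\<close> blocks of its orbit.\<close>

lemma variance_inside:
  assumes p: "0 \<le> p" "p \<le> 1" and ob: "ob \<in> Orb"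
  shows "subset_expect p V (\<lambda>U. (inside U ob - real (card ob) * p ^ k)\<^sup>2) \<le> (real k)\<^sup>2 * real (card ob)"
proof -
  have oC: "c \<in> C" if "c \<in> ob" for c using that ob Orb_sub by blast
  have "subset_expect p V (\<lambda>U. (real (card {c\<in>ob. blk c \<subseteq> U}) - real (card ob) * p ^ k)\<^sup>2)
      \<le> (real (k * k) + real (card ob) * 0) * real (card ob)"
  proof (rule variance_count[where T = blk])
    fix c assume c: "c \<in> ob"
    show "p ^ k \<le> subset_expect p V (\<lambda>S. of_bool (blk c \<subseteq> S))"
      using expect_subset[OF blk_sub[OF oC[OF c]]] card_blk[OF oC[OF c]] by simp
    have "card {g\<in>ob. blk c \<inter> blk g \<noteq> {}} \<le> k * k"
      using card_meeting[OF ob finite_blk[OF oC[OF c]]] card_blk[OF oC[OF c]] by (simp add: Int_commute)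
    then show "real (card {g\<in>ob. blk c \<inter> blk g \<noteq> {}}) \<le> real (k * k)" by (simp only: of_nat_le_iff)
  next
    fix c g assume c: "c \<in> ob" and g: "g \<in> ob" and dis: "blk c \<inter> blk g = {}"
    have "card (blk c \<union> blk g) = k + k"
      using dis oC[OF c] oC[OF g] by (simp add: card_Un_disjoint finite_blk card_blk)
    moreover have "blk c \<union> blk g \<subseteq> V" using blk_sub oC[OF c] oC[OF g] by blast
    ultimately have "subset_expect p V (\<lambda>S. of_bool (blk c \<union> blk g \<subseteq> S)) = p ^ k * p ^ k"
      using expect_subset[of "blk c \<union> blk g" p] by (simp add: power_add)
    then show "subset_expect p V (\<lambda>S. of_bool (blk c \<subseteq> S \<and> blk g \<subseteq> S)) \<le> p ^ k * p ^ k + 0"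
      by (simp add: Un_subset_iff)
  qed (use p finV finite_orbits(2)[OF ob] in auto)
  then show ?thesis by (simp add: inside_def power2_eq_square)
qed

text \<open>Two blocks through \<open>x\<close> are correlated only if they share a second point
  \<open>y\<close>, and each of the \<open>k - 1\<close> choices of \<open>y\<close> admits
  \<open>l\<close> blocks.\<close>

lemma variance_around:
  assumes p: "0 \<le> p" "p \<le> 1" and x: "x \<in> V"
  shows "subset_expect p V (\<lambda>U. (around U x - pdeg x * p ^ (k - 1))\<^sup>2) \<le> real (k * l) * pdeg x"
proof -
  define F where "F = {c\<in>C. x \<in> blk c}"
  have FC: "c \<in> C" "x \<in> blk c" if "c \<in> F" for c using that by (auto simp: F_def)
  have cT: "card (blk c - {x}) = k - 1" "finite (blk c - {x})" "blk c - {x} \<subseteq> V" if "c \<in> F" for c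
    using FC[OF that] card_blk finite_blk blk_sub by auto
  have "subset_expect p V (\<lambda>U. (real (card {c\<in>F. blk c - {x} \<subseteq> U}) - real (card F) * p ^ (k - 1))\<^sup>2)
      \<le> (real (k * l) + real (card F) * 0) * real (card F)"
  proof (rule variance_count[where T = "\<lambda>c. blk c - {x}"])
    fix c assume c: "c \<in> F"
    show "p ^ (k - 1) \<le> subset_expect p V (\<lambda>S. of_bool (blk c - {x} \<subseteq> S))"
      using expect_subset[OF cT(3)[OF c], of p] unfolding cT(1)[OF c] by (rule eq_refl[OF sym])
    have "{g\<in>F. (blk c - {x}) \<inter> (blk g - {x}) \<noteq> {}} \<subseteq> (\<Union>y\<in>blk c - {x}. {g\<in>C. x \<in> blk g \<and> y \<in> blk g})"
      by (auto simp: F_def)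
    then have "card {g\<in>F. (blk c - {x}) \<inter> (blk g - {x}) \<noteq> {}} \<le> card (\<Union>y\<in>blk c - {x}. {g\<in>C. x \<in> blk g \<and> y \<in> blk g})"
      using finC cT(2)[OF c] by (intro card_mono) auto
    also have "\<dots> \<le> (\<Sum>y\<in>blk c - {x}. card {g\<in>C. x \<in> blk g \<and> y \<in> blk g})"
      using cT(2)[OF c] by (rule card_UN_le)
    also have "\<dots> = (\<Sum>y\<in>blk c - {x}. l)"
      using cT(3)[OF c] by (intro sum.cong refl pair[OF x]) auto
    also have "\<dots> = (k - 1) * l" using cT(1)[OF c] by simp
    also have "\<dots> \<le> k * l" by simp
    finally show "real (card {g\<in>F. (blk c - {x}) \<inter> (blk g - {x}) \<noteq> {}}) \<le> real (k * l)"
      by (simp only: of_nat_le_iff)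
  next
    fix c g assume c: "c \<in> F" and g: "g \<in> F" and dis: "(blk c - {x}) \<inter> (blk g - {x}) = {}"
    have card_U: "card ((blk c - {x}) \<union> (blk g - {x})) = (k - 1) + (k - 1)"
      using card_Un_disjoint[OF cT(2)[OF c] cT(2)[OF g] dis] cT(1)[OF c] cT(1)[OF g] by linarith
    have "subset_expect p V (\<lambda>S. of_bool ((blk c - {x}) \<union> (blk g - {x}) \<subseteq> S)) = p ^ (k - 1) * p ^ (k - 1)"
      using expect_subset[of "(blk c - {x}) \<union> (blk g - {x})" p, OF Un_least[OF cT(3)[OF c] cT(3)[OF g]]]
      unfolding card_U power_add .
    then show "subset_expect p V (\<lambda>S. of_bool (blk c - {x} \<subseteq> S \<and> blk g - {x} \<subseteq> S)) \<le> p ^ (k - 1) * p ^ (k - 1) + 0"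
      unfolding Un_subset_iff by linarith
  qed (use p finV finC in \<open>auto simp: F_def\<close>)
  then show ?thesis by (simp add: around_def pdeg_def F_def conj_assoc)
qed

definition deviation :: "real \<Rightarrow> 'a set \<Rightarrow> real" where
  "deviation p W = (\<Sum>ob\<in>Orb. (inside W ob - real (card ob) * p ^ k)\<^sup>2)
     + (\<Sum>x\<in>V. (around W x - pdeg x * p ^ (k - 1))\<^sup>2)"

lemma expect_deviation:
  assumes "0 \<le> p" "p \<le> 1"
  shows "subset_expect p V (deviation p) \<le> real (k\<^sup>2 * (1 + l)) * real (card C)"
proof -
  have "subset_expect p V (deviation p) = (\<Sum>ob\<in>Orb. subset_expect p V (\<lambda>W. (inside W ob - real (card ob) * p ^ k)\<^sup>2))
     + (\<Sum>x\<in>V. subset_expect p V (\<lambda>W. (around W x - pdeg x * p ^ (k - 1))\<^sup>2))"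
    by (simp add: deviation_def[abs_def] subset_expect_add subset_expect_sum)
  also have "\<dots> \<le> (\<Sum>ob\<in>Orb. (real k)\<^sup>2 * real (card ob)) + (\<Sum>x\<in>V. real (k * l) * pdeg x)"
    using assms by (intro add_mono sum_mono variance_inside variance_around)
  also have "\<dots> = (real k)\<^sup>2 * real (card C) + real (k * l) * (real k * real (card C))"
    by (simp add: sum_pdeg flip: sum_distrib_left card_Orb_sum of_nat_sum)
  finally show ?thesis by (simp add: power2_eq_square algebra_simps)
qed

text \<open>The complement of a random set of density \<open>p\<close> is one of density
  \<open>1 - p\<close>, so one expectation controls both sides. The total deviation is O(v^2) and
  each exceptional orbit or point accounts for more than \<open>(\<beta> * v)\<^sup>2\<close>, so
  the number of exceptions is bounded independently of \<open>v\<close>.\<close>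

lemma random_split:
  assumes p: "0 \<le> p" "p \<le> 1" and \<beta>: "0 < \<beta>" and v: "0 < v"
  shows "\<exists>U\<subseteq>V. \<exists>A\<subseteq>Orb. \<exists>Z\<subseteq>V. real (card A + card Z) \<le> real (2 * k\<^sup>2 * (1 + l) * l) / \<beta>\<^sup>2
    \<and> (\<forall>ob\<in>Orb - A. \<bar>inside U ob - real (card ob) * p ^ k\<bar> \<le> \<beta> * v
         \<and> \<bar>inside (V - U) ob - real (card ob) * (1 - p) ^ k\<bar> \<le> \<beta> * v)
    \<and> (\<forall>x\<in>V - Z. \<bar>around U x - pdeg x * p ^ (k - 1)\<bar> \<le> \<beta> * v
         \<and> \<bar>around (V - U) x - pdeg x * (1 - p) ^ (k - 1)\<bar> \<le> \<beta> * v)"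
proof -
  let ?T = "\<lambda>U. deviation p U + deviation (1 - p) (V - U)"
  have "subset_expect p V ?T = subset_expect p V (deviation p) + subset_expect (1 - p) V (deviation (1 - p))"
    unfolding subset_expect_add using subset_expect_compl[OF finV, of p "deviation (1 - p)"] by simp
  also have "\<dots> \<le> 2 * (real (k\<^sup>2 * (1 + l)) * real (card C))"
    using expect_deviation[of p] expect_deviation[of "1 - p"] p by simp
  also have "\<dots> \<le> 2 * (real (k\<^sup>2 * (1 + l)) * real (l * v * v))"
    using card_C_le by (intro mult_left_mono) (auto simp only: of_nat_le_iff)
  finally have "- (2 * (real (k\<^sup>2 * (1 + l)) * real (l * v * v))) \<le> subset_expect p V (\<lambda>U. (-1) * ?T U)"
    unfolding subset_expect_cmult by linarith
  then obtain U where U: "U \<subseteq> V" "- (2 * (real (k\<^sup>2 * (1 + l)) * real (l * v * v))) \<le> (-1) * ?T U"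
    using subset_expect_ge_exists[OF finV p] by blast
  define g where "g ob = (inside U ob - real (card ob) * p ^ k)\<^sup>2
      + (inside (V - U) ob - real (card ob) * (1 - p) ^ k)\<^sup>2" for ob
  define h where "h x = (around U x - pdeg x * p ^ (k - 1))\<^sup>2
      + (around (V - U) x - pdeg x * (1 - p) ^ (k - 1))\<^sup>2" for x
  have T: "sum g Orb + sum h V \<le> real (2 * k\<^sup>2 * (1 + l) * l) * (real v)\<^sup>2"
    using U(2) by (simp add: deviation_def g_def h_def sum.distrib power2_eq_square mult_ac)
  define A where "A = {ob\<in>Orb. (\<beta> * v)\<^sup>2 < g ob}"
  define Z where "Z = {x\<in>V. (\<beta> * v)\<^sup>2 < h x}"
  have sq: "\<bar>a\<bar> \<le> \<beta> * v \<and> \<bar>b\<bar> \<le> \<beta> * v" if "a\<^sup>2 + b\<^sup>2 \<le> (\<beta> * v)\<^sup>2" for a b :: real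
  proof -
    have "\<bar>a\<bar>\<^sup>2 \<le> (\<beta> * v)\<^sup>2" "\<bar>b\<bar>\<^sup>2 \<le> (\<beta> * v)\<^sup>2"
      using that zero_le_power2[of a] zero_le_power2[of b] unfolding power2_abs by linarith+
    then show ?thesis using \<beta> by (auto intro: power2_le_imp_le)
  qed
  have "real (card A) * (\<beta> * v)\<^sup>2 + real (card Z) * (\<beta> * v)\<^sup>2 \<le> sum g A + sum h Z"
    by (intro add_mono sum_bounded_below) (auto simp: A_def Z_def)
  also have "\<dots> \<le> sum g Orb + sum h V"
    using finite_orbits(1) finV by (intro add_mono sum_mono2) (auto simp: A_def Z_def g_def h_def)
  finally have "(real (card A + card Z) * \<beta>\<^sup>2) * (real v)\<^sup>2 \<le> real (2 * k\<^sup>2 * (1 + l) * l) * (real v)\<^sup>2"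
    using T by (simp add: power_mult_distrib algebra_simps)
  then have "real (card A + card Z) * \<beta>\<^sup>2 \<le> real (2 * k\<^sup>2 * (1 + l) * l)" using v by simp
  then have "real (card A + card Z) \<le> real (2 * k\<^sup>2 * (1 + l) * l) / \<beta>\<^sup>2"
    using \<beta> by (simp add: pos_le_divide_eq)
  moreover have "\<bar>inside U ob - real (card ob) * p ^ k\<bar> \<le> \<beta> * v
         \<and> \<bar>inside (V - U) ob - real (card ob) * (1 - p) ^ k\<bar> \<le> \<beta> * v" if "ob \<in> Orb - A" for ob
    using that by (intro sq) (auto simp: A_def g_def)
  moreover have "\<bar>around U x - pdeg x * p ^ (k - 1)\<bar> \<le> \<beta> * v
         \<and> \<bar>around (V - U) x - pdeg x * (1 - p) ^ (k - 1)\<bar> \<le> \<beta> * v" if "x \<in> V - Z" for x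
    using that by (intro sq) (auto simp: Z_def h_def)
  ultimately show ?thesis using U(1) by (intro exI[of _ U] conjI exI[of _ A] exI[of _ Z]) (auto simp: A_def Z_def)
qed

section \<open>Assembling the parallel class\<close>

lemma inside_mono: "ob \<in> Orb \<Longrightarrow> W \<subseteq> W' \<Longrightarrow> inside W ob \<le> inside W' ob"
  unfolding inside_def using finite_orbits(2) by (intro of_nat_mono card_mono) auto

lemma around_mono: "W \<subseteq> W' \<Longrightarrow> around W x \<le> around W' x"
  unfolding around_def using finC by (intro of_nat_mono card_mono) auto

lemma inside_minus:
  "ob \<in> Orb \<Longrightarrow> finite Z \<Longrightarrow> inside W ob \<le> inside (W - Z) ob + real k * real (card Z)"
  using card_inside_minus[of ob Z W]
  by (simp add: inside_def flip: of_nat_add of_nat_mult)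

text \<open>Every point lies on l (v - 1) / (k - 1) blocks, and \<open>s * l \<le> k - 1\<close>
  makes this at most v / s. This is the comparison between point degrees and orbit sizes.\<close>

lemma pdeg_le:
  assumes "x \<in> V" "s * l \<le> k - 1" "0 < l"
  shows "real s * pdeg x \<le> real v"
proof -
  let ?d = "card {c\<in>C. x \<in> blk c}"
  have "l * (s * ?d) = (s * l) * ?d" by simp
  also have "\<dots> \<le> (k - 1) * ?d" using assms(2) by (rule mult_le_mono1)
  also have "\<dots> \<le> l * v" unfolding degree[OF assms(1)] by simp
  finally have "s * ?d \<le> v" using assms(3) by simp
  then show ?thesis unfolding pdeg_def by (metis of_nat_le_iff of_nat_mult)
qed

text \<open>
  \<open>P0\<close> serves the exceptional orbits \<open>B\<close>. Inside \<open>V - U\<close>, \<open>P1\<close> takes at most \<open>s - 1\<close> blocks of each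
  other orbit, and few are missing; \<open>P2\<close> supplies the missing ones inside \<open>U\<close>. What is left of \<open>U\<close>
  yields \<open>P3\<close>, an \<open>s\<close>-th block for almost all orbits. The point degree is at most \<open>v / s\<close>, which is why
  \<open>p = 1 / s\<close> is the right density for \<open>U\<close>.
\<close>

lemma parallel_class_if_large:
  fixes \<delta>1 \<delta>3 e1 e3 K0 p :: real
  assumes frac1: "\<And>H :: 'c set \<times> 'c \<times> nat \<Rightarrow> ('a + 'c set \<times> nat) set. matching_fraction H (k + 1) \<delta>1 (1 - e1 / 4)"
    and frac3: "\<And>H :: 'c set \<times> 'c \<times> nat \<Rightarrow> ('a + 'c set \<times> nat) set. matching_fraction H (k + 1) \<delta>3 (1 - e3 / 4)"
    and s: "2 \<le> s" "s * l \<le> k - 1" and l: "0 < l" and v: "0 < v"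
    and e: "0 < e1" "e1 \<le> e3" "e3 \<le> 1" and \<delta>: "0 < \<delta>1" "0 < \<delta>3"
    and p_def: "p = 1 / real s"
    and K0: "real K + real (2 * k\<^sup>2 * (1 + l) * l) / (e1 * p ^ k / (16 * s))\<^sup>2 \<le> K0"
    and n1: "real (l * s + k) \<le> \<delta>1 * (p ^ k * v)" "real (l * s + k) \<le> \<delta>3 * (p ^ k * v)"
    and n2: "real k * (real k * (real s * K0) + K0) \<le> e1 / 16 * (p ^ k * v)"
    and n3: "(real k)\<^sup>2 * real s * real l * e1 \<le> e3 / 16 * p ^ k"
    and n5: "real k ^ 3 * real s * K0 \<le> v"
  shows "\<exists>P X. P \<subseteq> C \<and> matching_of blk P \<and> X \<subseteq> Orb \<and> real (card X) \<le> K0 + e3 * real (card Orb)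
    \<and> (\<forall>ob\<in>X. card (P \<inter> ob) = s - 1) \<and> (\<forall>ob\<in>Orb - X. card (P \<inter> ob) = s)"
proof -
  have s2: "2 \<le> real s" using s by simp
  have p: "0 < p" "p \<le> 1 / 2" "p \<le> 1" "0 \<le> p" using s2 by (auto simp: p_def field_simps)
  have ps: "p * real s = 1" using s2 by (simp add: p_def)
  define a where "a = 1 - p"
  have a: "p \<le> a" "a \<le> 1" "0 < a" using p by (auto simp: a_def)
  \<comment> \<open>The balance behind the density: \<open>s - 1\<close> copies cost a point
    \<open>(s - 1) * pdeg x * a ^ (k - 1) = s * pdeg x * a ^ k\<close>, and one copy inside
    \<open>U\<close> costs \<open>pdeg x * p ^ (k - 1) = s * pdeg x * p ^ k\<close>. Both are at
    most the expected size of a full orbit in the region, \<open>Q\<close> and \<open>q\<close>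
    respectively.\<close>
  have as: "real (s - 1) = a * real s" using s ps by (simp add: a_def algebra_simps of_nat_diff)
  have pk: "0 < p ^ k" "p ^ k \<le> a ^ k" using p a by (auto intro: power_mono)
  \<comment> \<open>Even after multiplication by the number of copies, at most \<open>s\<close>, the
    deviation \<open>\<beta> * v\<close> stays within \<open>e1 / 16 * q\<close>.\<close>
  define \<beta> where "\<beta> = e1 * p ^ k / (16 * s)"
  have \<beta>: "0 < \<beta>" using e pk s2 by (simp add: \<beta>_def)
  have s\<beta>: "real s * \<beta> = e1 / 16 * p ^ k" using s2 by (simp add: \<beta>_def)
  have "1 * \<beta> \<le> real s * \<beta>" using s2 \<beta> by (intro mult_right_mono) auto
  then have \<beta>1: "\<beta> \<le> e1 / 16 * p ^ k" using s\<beta> by simp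
  have v0: "0 < real v" using v by simp
  define q where "q = p ^ k * real v"
  define Q where "Q = a ^ k * real v"
  have q: "0 < q" "q \<le> Q" using pk v0 by (auto simp: q_def Q_def intro: mult_right_mono)
  have \<beta>v: "\<beta> * v \<le> e1 / 16 * q"
    using mult_right_mono[OF \<beta>1, of "real v"] v0 by (simp add: q_def mult.assoc)
  have s\<beta>v: "real s * (\<beta> * v) = e1 / 16 * q"
    using s\<beta> by (simp add: q_def mult.assoc[symmetric])
  have e1q: "e1 * q \<le> e1 * Q" "e1 * q \<le> e3 * q" "e3 * q \<le> q"
    using q e mult_right_mono[of e3 1 q] by (auto intro: mult_left_mono mult_right_mono)
  have ex: "(1 + e1 / 4) * Q = Q + e1 * Q / 4" "(1 - e1 / 4) * Q = Q - e1 * Q / 4"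
    "(1 + e3 / 4) * q = q + e3 * q / 4" "(1 - e3 / 4) * q = q - e3 * q / 4"
    "real v * a ^ k = Q"
    by (simp_all add: algebra_simps Q_def)
  have e1q0: "0 < e1 * q" using e q by simp
  obtain U A Zb where U: "U \<subseteq> V" and A: "A \<subseteq> Orb" and Zb: "Zb \<subseteq> V"
    and few: "real (card A + card Zb) \<le> real (2 * k\<^sup>2 * (1 + l) * l) / \<beta>\<^sup>2"
    and okU: "\<And>ob. ob \<in> Orb - A \<Longrightarrow> \<bar>inside U ob - real (card ob) * p ^ k\<bar> \<le> \<beta> * v"
    and okVU: "\<And>ob. ob \<in> Orb - A \<Longrightarrow> \<bar>inside (V - U) ob - real (card ob) * a ^ k\<bar> \<le> \<beta> * v"
    and okx: "\<And>x. x \<in> V - Zb \<Longrightarrow> \<bar>around U x - pdeg x * p ^ (k - 1)\<bar> \<le> \<beta> * v"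
    and okVx: "\<And>x. x \<in> V - Zb \<Longrightarrow> \<bar>around (V - U) x - pdeg x * a ^ (k - 1)\<bar> \<le> \<beta> * v"
    using random_split[OF p(4,3) \<beta> v] unfolding a_def by blast
  define B where "B = A \<union> {ob\<in>Orb. card ob \<noteq> v}"
  define G where "G = Orb - B"
  have B: "B \<subseteq> Orb" using A by (auto simp: B_def)
  have G: "G \<subseteq> Orb" by (auto simp: G_def)
  have finG: "finite G" using finite_subset[OF G finite_orbits(1)] .
  have "card B \<le> card A + K" unfolding B_def using card_Un_le[of A "{ob\<in>Orb. card ob \<noteq> v}"] short by linarith
  then have "real (card B) \<le> real (card A) + real K" by (simp flip: of_nat_add)
  then have cBZ: "real (card B) + real (card Zb) \<le> K0"
    using few K0 unfolding \<beta>_def by simp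
  then have cB: "real (card B) \<le> K0" and cZ: "real (card Zb) \<le> K0" by auto
  have K00: "0 \<le> K0" using cB by linarith
  have GA: "ob \<in> Orb - A" "card ob = v" if "ob \<in> G" for ob using that by (auto simp: G_def B_def)

  have "\<exists>P\<subseteq>\<Union>B. matching_of blk P \<and> (\<forall>c\<in>P. blk c \<subseteq> V - {}) \<and> (\<forall>ob\<in>B. card (P \<inter> ob) = s - 1)"
  proof (rule greedy[OF B finite.emptyI])
    fix ob assume ob: "ob \<in> B" "0 < s - 1"
    then have obO: "ob \<in> Orb" using B by blast
    \<comment> \<open>One factor \<open>k\<close> comes from the orbit size being only at least
      \<open>v / k\<close>, since the exceptional orbits may be short; the other two are those of
      \<open>greedy\<close>.\<close>
    have "real (k * (k * (k * ((s - 1) * card B)))) = real k ^ 3 * real (s - 1) * real (card B)"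
      by (simp add: power3_eq_cube)
    also have "\<dots> \<le> real k ^ 3 * real s * K0" using cB by (intro mult_mono) auto
    also have "\<dots> \<le> real v" by (rule n5)
    finally have "k * (k * (k * ((s - 1) * card B))) \<le> v" by (simp only: of_nat_le_iff)
    also have "\<dots> \<le> k * card ob" by (rule large[OF obO])
    finally have "k * (k * ((s - 1) * card B)) \<le> card ob" using k by simp
    moreover have "{c\<in>ob. blk c \<subseteq> V} = ob" using blk_sub Orb_sub[OF obO] by blast
    ultimately show "k * (card {} + k * (\<Sum>ob\<in>B. s - 1)) \<le> card {c\<in>ob. blk c \<subseteq> V}"
      by (simp add: mult_ac)
  qed
  then obtain P0 where P0: "P0 \<subseteq> \<Union>B" "matching_of blk P0" "\<forall>ob\<in>B. card (P0 \<inter> ob) = s - 1" by blast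
  have P0C: "P0 \<subseteq> C" using P0(1) B Union_Orb by blast
  define Z0 where "Z0 = \<Union>(blk ` P0)"
  have finZ0: "finite Z0" unfolding Z0_def using finite_subset[OF P0C finC] finite_blk P0C by blast
  have "card P0 = (\<Sum>ob\<in>B. s - 1)" using sum_card_orbits[OF B P0(1)] P0(3) by simp
  then have "card Z0 \<le> k * (card B * (s - 1))" using card_points_le[OF P0C] by (simp add: Z0_def)
  then have "real (card Z0) \<le> real (k * (card B * (s - 1)))" by (simp only: of_nat_le_iff)
  also have "\<dots> \<le> real k * (K0 * real s)"
    unfolding of_nat_mult using cB K00 by (intro mult_left_mono mult_mono) auto
  also have "\<dots> = real k * (real s * K0)" by simp
  finally have cZ0: "real (card Z0) \<le> real k * (real s * K0)" .
  \<comment> \<open>Both matchings avoid the badly behaved points \<open>Zb\<close>, because they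
    need degree bounds at every point of their region. The greedy repair avoids just the points
    \<open>Z0\<close> covered by \<open>P0\<close>.\<close>
  define Z where "Z = Z0 \<union> Zb"
  have finZ: "finite Z" using finZ0 finite_subset[OF Zb finV] by (simp add: Z_def)
  have "card Z \<le> card Z0 + card Zb" unfolding Z_def by (rule card_Un_le)
  then have "real (card Z) \<le> real k * (real s * K0) + K0" using cZ0 cZ by linarith
  then have "real k * real (card Z) \<le> real k * (real k * (real s * K0) + K0)" by (rule mult_left_mono) simp
  then have kZ: "real k * real (card Z) \<le> e1 / 16 * q" using n2 by (simp add: q_def)
  have "real k * real (card Z0) \<le> real k * real (card Z)"
    using card_mono[OF finZ, of Z0] by (intro mult_left_mono) (auto simp: Z_def)
  then have kZ0: "real k * real (card Z0) \<le> e1 / 16 * q" using kZ by linarith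
  have pd: "real s * pdeg x \<le> v" if "x \<in> V" for x by (rule pdeg_le[OF that s(2) l])
  have kk: "b ^ k = b * b ^ (k - 1)" for b :: real using k by (simp flip: power_Suc)

  define W1 where "W1 = (V - U) - Z"
  have "\<exists>P\<subseteq>\<Union>G. matching_of blk P \<and> (\<forall>c\<in>P. blk c \<subseteq> W1) \<and> (\<forall>ob\<in>G. card (P \<inter> ob) \<le> s - 1)
     \<and> (1 - e1) * (real (s - 1) * real (card G)) \<le> real (card P)"
  proof (rule matching_in_region[where Q = Q])
    fix x assume x: "x \<in> W1"
    then have xV: "x \<in> V" "x \<in> V - Zb" by (auto simp: W1_def Z_def)
    have "real (s - 1) * around W1 x \<le> real (s - 1) * around (V - U) x"
      by (intro mult_left_mono around_mono) (auto simp: W1_def)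
    also have "\<dots> \<le> real (s - 1) * (pdeg x * a ^ (k - 1) + \<beta> * v)"
      using okVx[OF xV(2)] by (intro mult_left_mono) auto
    also have "\<dots> = (real s * pdeg x) * (a * a ^ (k - 1)) + real (s - 1) * (\<beta> * v)"
      unfolding as by (simp add: algebra_simps)
    also have "\<dots> \<le> v * a ^ k + real s * (\<beta> * v)"
      unfolding kk[of a] using pd[OF xV(1)] a \<beta> by (intro add_mono mult_right_mono) auto
    also have "\<dots> \<le> (1 + e1 / 4) * Q" using s\<beta>v e1q e1q0 unfolding ex by linarith
    finally show "real (s - 1) * real (card {c\<in>C. x \<in> blk c \<and> blk c - {x} \<subseteq> W1}) \<le> (1 + e1 / 4) * Q"
      by (simp add: around_def)
  next
    fix ob assume ob: "ob \<in> G"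
    have obO: "ob \<in> Orb" using ob G by blast
    have mid: "\<bar>inside (V - U) ob - Q\<bar> \<le> \<beta> * v"
      using okVU[OF GA(1)[OF ob]] by (simp add: GA(2)[OF ob] Q_def mult.commute)
    have "inside W1 ob \<le> inside (V - U) ob" using obO by (intro inside_mono) (auto simp: W1_def)
    then show "real (card {c\<in>ob. blk c \<subseteq> W1}) \<le> (1 + e1 / 4) * Q"
      using mid \<beta>v e1q e1q0 unfolding inside_def ex by linarith
    have "inside (V - U) ob \<le> inside W1 ob + real k * real (card Z)"
      unfolding W1_def by (rule inside_minus[OF obO finZ])
    then show "(1 - e1 / 4) * Q \<le> real (card {c\<in>ob. blk c \<subseteq> W1})"
      using mid \<beta>v e1q kZ e1q0 unfolding inside_def ex by linarith
  next
    have "l * (s - 1) + k \<le> l * s + k" by simp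
    then have "real (l * (s - 1) + k) \<le> real (l * s + k)" by (simp only: of_nat_le_iff)
    also have "\<dots> \<le> \<delta>1 * q" using n1 by (simp add: q_def)
    also have "\<dots> \<le> \<delta>1 * Q" using q \<delta> by (intro mult_left_mono) auto
    finally show "real (l * (s - 1) + k) \<le> \<delta>1 * Q" .
  qed (use frac1 e q G \<delta> in \<open>auto simp: W1_def\<close>)
  then obtain P1 where P1: "P1 \<subseteq> \<Union>G" "matching_of blk P1" "\<forall>c\<in>P1. blk c \<subseteq> W1"
    "\<forall>ob\<in>G. card (P1 \<inter> ob) \<le> s - 1" "(1 - e1) * (real (s - 1) * real (card G)) \<le> real (card P1)" by blast

  define f where "f ob = s - 1 - card (P1 \<inter> ob)" for ob
  define F where "F = sum f G"
  have "card P1 + F = (\<Sum>ob\<in>G. card (P1 \<inter> ob) + f ob)"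
    using sum_card_orbits[OF G P1(1)] by (simp add: F_def sum.distrib)
  also have "\<dots> = (\<Sum>ob\<in>G. s - 1)" using P1(4) by (intro sum.cong) (auto simp: f_def)
  also have "\<dots> = (s - 1) * card G" by simp
  finally have sum_f: "real (card P1) + real F = real (s - 1) * real (card G)"
    by (metis of_nat_add of_nat_mult)
  have "card G \<le> l * v"
    using card_mono[OF finite_orbits(1) G] card_Orb_upper[OF v] by linarith
  then have cG: "real (card G) \<le> real l * real v" by (simp flip: of_nat_mult)
  have "(1 - e1) * y = y - e1 * y" for y by (simp add: algebra_simps)
  then have "real F \<le> e1 * (real (s - 1) * real (card G))"
    using P1(5) unfolding sum_f[symmetric] by auto
  also have "\<dots> \<le> e1 * (real s * (real l * real v))"
    using cG e by (intro mult_left_mono mult_mono) auto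
  finally have "(real k)\<^sup>2 * real (F) \<le> (real k)\<^sup>2 * (e1 * (real s * (real l * real v)))"
    by (rule mult_left_mono) simp
  also have "\<dots> = ((real k)\<^sup>2 * real s * real l * e1) * v" by (simp add: mult_ac)
  also have "\<dots> \<le> e3 / 16 * p ^ k * v" by (rule mult_right_mono[OF n3]) simp
  \<comment> \<open>One factor \<open>k\<close> turns missing blocks into covered points, the other
    turns covered points into spoiled blocks of an orbit. The bound thus serves twice: as room for
    the repair, and as damage to \<open>U\<close> before the second matching.\<close>
  finally have kkf: "(real k)\<^sup>2 * real (F) \<le> e3 / 16 * q" by (simp add: q_def)
  have midU: "\<bar>inside U ob - q\<bar> \<le> \<beta> * v" if ob: "ob \<in> G" for ob
    using okU[OF GA(1)[OF ob]] by (simp add: GA(2)[OF ob] q_def mult.commute)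
  have "\<exists>P\<subseteq>\<Union>G. matching_of blk P \<and> (\<forall>c\<in>P. blk c \<subseteq> U - Z0) \<and> (\<forall>ob\<in>G. card (P \<inter> ob) = f ob)"
  proof (rule greedy[OF G finZ0])
    fix ob assume ob: "ob \<in> G"
    have "real (k * (card Z0 + k * F)) = real k * real (card Z0) + (real k)\<^sup>2 * real (F)"
      by (simp add: power2_eq_square algebra_simps)
    also have "\<dots> \<le> e1 / 16 * q + e3 / 16 * q" using kZ0 kkf by linarith
    also have "\<dots> \<le> inside U ob" using midU[OF ob] \<beta>v e1q by linarith
    finally show "k * (card Z0 + k * sum f G) \<le> card {c\<in>ob. blk c \<subseteq> U}"
      unfolding inside_def F_def[symmetric] by (simp only: of_nat_le_iff)
  qed
  then obtain P2 where P2: "P2 \<subseteq> \<Union>G" "matching_of blk P2" "\<forall>c\<in>P2. blk c \<subseteq> U - Z0"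
    "\<forall>ob\<in>G. card (P2 \<inter> ob) = f ob" by blast
  have P2C: "P2 \<subseteq> C" using P2(1) G Union_Orb by blast
  define Z2 where "Z2 = \<Union>(blk ` P2)"
  have finZ2: "finite Z2" unfolding Z2_def using finite_subset[OF P2C finC] finite_blk P2C by blast
  have "card P2 = F" using sum_card_orbits[OF G P2(1)] P2(4) by (simp add: F_def)
  then have "card Z2 \<le> k * F" using card_points_le[OF P2C] by (simp add: Z2_def)
  then have "real (card Z2) \<le> real k * real (F)" by (simp only: of_nat_le_iff flip: of_nat_mult)
  then have "real k * real (card Z2) \<le> (real k)\<^sup>2 * real (F)"
    using mult_left_mono[of "real (card Z2)" "real k * real (F)" "real k"]
    by (simp add: power2_eq_square mult.assoc)
  then have kZ2: "real k * real (card Z2) \<le> e3 / 16 * q" using kkf by linarith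
  have "card (Z \<union> Z2) \<le> card Z + card Z2" by (rule card_Un_le)
  then have "real (card (Z \<union> Z2)) \<le> real (card Z) + real (card Z2)" by (simp flip: of_nat_add)
  then have "real k * real (card (Z \<union> Z2)) \<le> real k * (real (card Z) + real (card Z2))"
    by (rule mult_left_mono) simp
  then have kZZ: "real k * real (card (Z \<union> Z2)) \<le> e3 / 8 * q"
    using kZ kZ2 e1q by (simp add: distrib_left)

  define W3 where "W3 = U - (Z \<union> Z2)"
  have "\<exists>P\<subseteq>\<Union>G. matching_of blk P \<and> (\<forall>c\<in>P. blk c \<subseteq> W3) \<and> (\<forall>ob\<in>G. card (P \<inter> ob) \<le> 1)
     \<and> (1 - e3) * (real 1 * real (card G)) \<le> real (card P)"
  proof (rule matching_in_region[where Q = q])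
    fix x assume x: "x \<in> W3"
    then have xV: "x \<in> V" "x \<in> V - Zb" using U by (auto simp: W3_def Z_def)
    have "around W3 x \<le> around U x" by (intro around_mono) (auto simp: W3_def)
    also have "\<dots> \<le> pdeg x * p ^ (k - 1) + \<beta> * v" using okx[OF xV(2)] by linarith
    also have "pdeg x * p ^ (k - 1) = (real s * pdeg x) * (p * p ^ (k - 1))"
      using ps by (simp add: mult_ac)
    also have "\<dots> \<le> v * p ^ k"
      unfolding kk[of p] using pd[OF xV(1)] p by (intro mult_right_mono) auto
    finally have "around W3 x \<le> q + \<beta> * v" by (simp add: q_def mult.commute)
    then have "around W3 x \<le> (1 + e3 / 4) * q" using \<beta>v e1q e1q0 unfolding ex by linarith
    then show "real 1 * real (card {c\<in>C. x \<in> blk c \<and> blk c - {x} \<subseteq> W3}) \<le> (1 + e3 / 4) * q"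
      by (simp add: around_def)
  next
    fix ob assume ob: "ob \<in> G"
    have obO: "ob \<in> Orb" using ob G by blast
    have "inside W3 ob \<le> inside U ob" using obO by (intro inside_mono) (auto simp: W3_def)
    then show "real (card {c\<in>ob. blk c \<subseteq> W3}) \<le> (1 + e3 / 4) * q"
      using midU[OF ob] \<beta>v e1q e1q0 unfolding inside_def ex by linarith
    have "inside U ob \<le> inside W3 ob + real k * real (card (Z \<union> Z2))"
      unfolding W3_def using finZ finZ2 by (intro inside_minus[OF obO]) simp
    then show "(1 - e3 / 4) * q \<le> real (card {c\<in>ob. blk c \<subseteq> W3})"
      using midU[OF ob] \<beta>v e1q kZZ e1q0 unfolding inside_def ex by linarith
  next
    have "l * 1 + k \<le> l * s + k" using s by simp
    then have "real (l * 1 + k) \<le> real (l * s + k)" by (simp only: of_nat_le_iff)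
    also have "\<dots> \<le> \<delta>3 * q" using n1 by (simp add: q_def)
    finally show "real (l * 1 + k) \<le> \<delta>3 * q" .
  qed (use frac3 e q G U \<delta> in \<open>auto simp: W3_def\<close>)
  then obtain P3 where P3: "P3 \<subseteq> \<Union>G" "matching_of blk P3" "\<forall>c\<in>P3. blk c \<subseteq> W3"
    "\<forall>ob\<in>G. card (P3 \<inter> ob) \<le> 1" "(1 - e3) * real (card G) \<le> real (card P3)" by auto
  have P1C: "P1 \<subseteq> C" and P3C: "P3 \<subseteq> C" using P1(1) P3(1) G Union_Orb by blast+

  define P where "P = P0 \<union> P1 \<union> P2 \<union> P3"
  \<comment> \<open>Orbits in \<open>B\<close> receive blocks from \<open>P0\<close> only. Every
    orbit in \<open>G\<close> has exactly \<open>s - 1\<close> blocks in \<open>P1\<close> and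
    \<open>P2\<close> together, so \<open>P3\<close> alone decides between \<open>s - 1\<close> and
    \<open>s\<close>.\<close>
  define X where "X = B \<union> {ob\<in>G. P3 \<inter> ob = {}}"
  have PC: "P \<subseteq> C" using P0C P1C P2C P3C by (auto simp: P_def)
  have r0: "blk c \<subseteq> Z0" if "c \<in> P0" for c using that by (auto simp: Z0_def)
  have r1: "blk c \<subseteq> V - U - Z0" if "c \<in> P1" for c using that P1(3) by (auto simp: W1_def Z_def)
  have r2: "blk c \<subseteq> U \<inter> Z2 - Z0" if "c \<in> P2" for c using that P2(3) by (auto simp: Z2_def)
  have r3: "blk c \<subseteq> U - Z0 - Z2" if "c \<in> P3" for c using that P3(3) by (auto simp: W3_def Z_def)
  have d01: "disjnt (blk c) (blk c')" if "c \<in> P0" "c' \<in> P1" for c c'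
    using r0[OF that(1)] r1[OF that(2)] by (auto simp: disjnt_def)
  have d02: "disjnt (blk c) (blk c')" if "c \<in> P0" "c' \<in> P2" for c c'
    using r0[OF that(1)] r2[OF that(2)] by (auto simp: disjnt_def)
  have d03: "disjnt (blk c) (blk c')" if "c \<in> P0" "c' \<in> P3" for c c'
    using r0[OF that(1)] r3[OF that(2)] by (auto simp: disjnt_def)
  have d12: "disjnt (blk c) (blk c')" if "c \<in> P1" "c' \<in> P2" for c c'
    using r1[OF that(1)] r2[OF that(2)] by (auto simp: disjnt_def)
  have d13: "disjnt (blk c) (blk c')" if "c \<in> P1" "c' \<in> P3" for c c'
    using r1[OF that(1)] r3[OF that(2)] by (auto simp: disjnt_def)
  have d23: "disjnt (blk c) (blk c')" if "c \<in> P2" "c' \<in> P3" for c c'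
    using r2[OF that(1)] r3[OF that(2)] by (auto simp: disjnt_def)
  have matching_Un: "matching_of blk (R \<union> S)"
    if "matching_of blk R" "matching_of blk S" "\<And>c c'. c \<in> R \<Longrightarrow> c' \<in> S \<Longrightarrow> disjnt (blk c) (blk c')" for R S
    using that disjnt_sym[OF that(3)] unfolding matching_of_def pairwise_def by blast
  have mP: "matching_of blk P"
    unfolding P_def using d01 d02 d03 d12 d13 d23
    by (intro matching_Un P0(2) P1(2) P2(2) P3(2)) blast+
  have nodup: "c' \<noteq> c" if "disjnt (blk c) (blk c')" "c \<in> C" for c c'
    using that blk_nonempty[OF that(2)] by (auto simp: disjnt_def)
  have card_G: "card (P \<inter> ob) = s - 1 + card (P3 \<inter> ob)" if ob: "ob \<in> G" for ob
  proof -
    have "c \<notin> ob" if cP: "c \<in> P0" for c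
    proof
      assume "c \<in> ob"
      obtain ob' where "ob' \<in> B" "c \<in> ob'" using cP P0(1) by blast
      then have "ob' = ob" using Orb_disjoint[of ob' ob c] \<open>c \<in> ob\<close> ob G B by blast
      then show False using \<open>ob' \<in> B\<close> ob by (simp add: G_def)
    qed
    then have Po: "P \<inter> ob = (P1 \<inter> ob) \<union> ((P2 \<inter> ob) \<union> (P3 \<inter> ob))" by (auto simp: P_def)
    have "finite ob" using ob G finite_orbits(2) by blast
    moreover have "(P1 \<inter> ob) \<inter> ((P2 \<inter> ob) \<union> (P3 \<inter> ob)) = {}"
      using nodup[OF d12] nodup[OF d13] P1C by blast
    moreover have "(P2 \<inter> ob) \<inter> (P3 \<inter> ob) = {}" using nodup[OF d23] P2C by blast
    ultimately have "card (P \<inter> ob) = card (P1 \<inter> ob) + (card (P2 \<inter> ob) + card (P3 \<inter> ob))"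
      unfolding Po by (simp add: card_Un_disjoint)
    moreover have "card (P2 \<inter> ob) = s - 1 - card (P1 \<inter> ob)" using P2(4) ob by (simp add: f_def)
    moreover have "card (P1 \<inter> ob) \<le> s - 1" using P1(4) ob by blast
    ultimately show ?thesis by linarith
  qed
  have card_B: "card (P \<inter> ob) = s - 1" if ob: "ob \<in> B" for ob
  proof -
    have "c \<notin> ob" if cG: "c \<in> \<Union>G" for c
    proof
      assume "c \<in> ob"
      obtain ob' where "ob' \<in> G" "c \<in> ob'" using cG by blast
      then have "ob' = ob" using Orb_disjoint[of ob' ob c] \<open>c \<in> ob\<close> ob G B by blast
      then show False using \<open>ob' \<in> G\<close> ob by (simp add: G_def)
    qed
    then have "P \<inter> ob = P0 \<inter> ob" using P1(1) P2(1) P3(1) unfolding P_def by blast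
    then show ?thesis using P0(3) ob by simp
  qed
  have "real (card X) \<le> K0 + e3 * real (card Orb)"
  proof -
    have "card P3 = (\<Sum>ob\<in>G. card (P3 \<inter> ob))" using sum_card_orbits[OF G P3(1)] by simp
    also have "\<dots> \<le> (\<Sum>ob\<in>G. of_bool (P3 \<inter> ob \<noteq> {}))" using P3(4) by (intro sum_mono) auto
    also have "\<dots> = card {ob\<in>G. P3 \<inter> ob \<noteq> {}}" using finG by (simp add: Int_def)
    finally have "card P3 \<le> card {ob\<in>G. P3 \<inter> ob \<noteq> {}}" .
    moreover have "card {ob\<in>G. P3 \<inter> ob \<noteq> {}} + card {ob\<in>G. P3 \<inter> ob = {}} = card G"
    proof -
      have "G = {ob\<in>G. P3 \<inter> ob \<noteq> {}} \<union> {ob\<in>G. P3 \<inter> ob = {}}" by blast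
      also have "card \<dots> = card {ob\<in>G. P3 \<inter> ob \<noteq> {}} + card {ob\<in>G. P3 \<inter> ob = {}}"
        using finG by (intro card_Un_disjoint) auto
      finally show ?thesis ..
    qed
    ultimately have "real (card P3) + real (card {ob\<in>G. P3 \<inter> ob = {}}) \<le> real (card G)"
      by (simp flip: of_nat_add)
    then have "real (card {ob\<in>G. P3 \<inter> ob = {}}) \<le> e3 * real (card G)"
      using P3(5) by (simp add: algebra_simps)
    also have "\<dots> \<le> e3 * real (card Orb)"
      using card_mono[OF finite_orbits(1) G] e by (intro mult_left_mono) auto
    finally show ?thesis
      using cB card_Un_le[of B "{ob\<in>G. P3 \<inter> ob = {}}"] unfolding X_def by linarith
  qed
  moreover have "card (P \<inter> ob) = s - 1" if "ob \<in> X" for ob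
    using that card_B card_G by (auto simp: X_def)
  moreover have "card (P \<inter> ob) = s" if "ob \<in> Orb - X" for ob
  proof -
    have ob: "ob \<in> G" "P3 \<inter> ob \<noteq> {}" using that by (auto simp: X_def G_def)
    have "finite (P3 \<inter> ob)" using ob(1) G finite_orbits(2) by blast
    then have "0 < card (P3 \<inter> ob)" using ob(2) by (simp add: card_gt_0_iff)
    then have "card (P3 \<inter> ob) = 1" using P3(4) ob(1) by (simp add: le_antisym Suc_leI)
    then show ?thesis using card_G[OF ob(1)] s by simp
  qed
  moreover have "X \<subseteq> Orb" using B G by (auto simp: X_def)
  ultimately show ?thesis using PC mP by blast
qed

end

text \<open>Order of the constants: half of \<open>\<epsilon>\<close> goes to \<open>e3\<close> and
  half to \<open>K0\<close>; \<open>e1\<close> is made small against \<open>e3\<close> so that the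
  repair hardly disturbs \<open>U\<close>; then come the codegree ratios and \<open>K0\<close>, and
  \<open>v\<close> last.\<close>

lemma block_system_parallel_class:
  fixes k l s K :: nat and \<epsilon> :: real
  assumes s: "2 \<le> s" "s * l \<le> k - 1" and l: "0 < l" and \<epsilon>: "0 < \<epsilon>"
  shows "\<exists>v0. \<forall>v\<ge>v0. \<forall>(V :: 'a set) (C :: 'c set) blk Orb. block_system V C blk Orb v k l K \<longrightarrow>
    (\<exists>P X. P \<subseteq> C \<and> matching_of blk P \<and> X \<subseteq> Orb \<and> real (card X) \<le> \<epsilon> * real (card Orb)
      \<and> (\<forall>ob\<in>X. card (P \<inter> ob) = s - 1) \<and> (\<forall>ob\<in>Orb - X. card (P \<inter> ob) = s))"
proof -
  have "2 * 1 \<le> s * l" using s l by (intro mult_le_mono) auto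
  then have k: "2 \<le> k" using s by linarith
  define p where "p = 1 / real s"
  define e3 where "e3 = min (\<epsilon> / 2) 1"
  define e1 where "e1 = min e3 (e3 / 16 * p ^ k / ((real k)\<^sup>2 * real s * real l))"
  have pos: "0 < real s" "0 < real l" "0 < real k" using s l k by auto
  have p: "0 < p ^ k" using pos by (simp add: p_def)
  have e3: "0 < e3" "e3 \<le> 1" "e3 \<le> \<epsilon> / 2" using \<epsilon> by (auto simp: e3_def)
  have e1: "0 < e1" "e1 \<le> e3" using e3 p pos by (auto simp: e1_def)
  have n3: "(real k)\<^sup>2 * real s * real l * e1 \<le> e3 / 16 * p ^ k"
  proof -
    have "e1 \<le> e3 / 16 * p ^ k / ((real k)\<^sup>2 * real s * real l)" by (simp add: e1_def)
    then show ?thesis using pos by (simp add: pos_le_divide_eq mult.commute)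
  qed
  obtain \<delta>1 where \<delta>1: "0 < \<delta>1"
    "\<And>H :: 'c set \<times> 'c \<times> nat \<Rightarrow> ('a + 'c set \<times> nat) set. matching_fraction H (k + 1) \<delta>1 (1 - e1 / 4)"
    using pippenger_matching[of "k + 1" "e1 / 4"] k e1 by auto
  obtain \<delta>3 where \<delta>3: "0 < \<delta>3"
    "\<And>H :: 'c set \<times> 'c \<times> nat \<Rightarrow> ('a + 'c set \<times> nat) set. matching_fraction H (k + 1) \<delta>3 (1 - e3 / 4)"
    using pippenger_matching[of "k + 1" "e3 / 4"] k e3 by auto
  define K0 where "K0 = real K + real (2 * k\<^sup>2 * (1 + l) * l) / (e1 * p ^ k / (16 * s))\<^sup>2"
  have K0: "0 \<le> K0" by (simp add: K0_def)
  define b1 where "b1 = real (l * s + k) / (\<delta>1 * p ^ k)"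
  define b2 where "b2 = real (l * s + k) / (\<delta>3 * p ^ k)"
  define b3 where "b3 = real k * (real k * (real s * K0) + K0) / (e1 / 16 * p ^ k)"
  define b4 where "b4 = real k ^ 3 * real s * K0"
  \<comment> \<open>\<open>card_Orb_lower\<close> gives \<open>v \<le> k * k * card Orb + 1\<close>,
    so \<open>v \<ge> b5\<close> forces \<open>K0\<close> below
    \<open>\<epsilon> / 2 * card Orb\<close>.\<close>
  define b5 where "b5 = 2 * K0 * (real k)\<^sup>2 / \<epsilon> + 1"
  have b: "0 \<le> b1" "0 \<le> b2" "0 \<le> b3" "0 \<le> b4" "0 < b5"
    using \<delta>1(1) \<delta>3(1) e1 K0 p \<epsilon> by (auto simp: b1_def b2_def b3_def b4_def b5_def intro: add_nonneg_pos)
  show ?thesis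
  proof (intro exI[of _ "nat \<lceil>b1 + b2 + b3 + b4 + b5\<rceil>"] allI impI)
    fix v and V :: "'a set" and C :: "'c set" and blk Orb
    assume "nat \<lceil>b1 + b2 + b3 + b4 + b5\<rceil> \<le> v" and bs: "block_system V C blk Orb v k l K"
    then have sum: "b1 + b2 + b3 + b4 + b5 \<le> real v" by linarith
    interpret block_system V C blk Orb v k l K by fact
    have v: "b1 \<le> v" "b2 \<le> v" "b3 \<le> v" "b4 \<le> v" "b5 \<le> v" "0 < v" using sum b by linarith+
    have n1: "real (l * s + k) \<le> \<delta>1 * (p ^ k * v)" "real (l * s + k) \<le> \<delta>3 * (p ^ k * v)"
      using v(1,2) \<delta>1(1) \<delta>3(1) p unfolding b1_def b2_def by (simp_all add: pos_divide_le_eq mult_ac)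
    have n2: "real k * (real k * (real s * K0) + K0) \<le> e1 / 16 * (p ^ k * v)"
      using v(3) e1 p unfolding b3_def by (simp add: pos_divide_le_eq mult_ac)
    have n5: "real k ^ 3 * real s * K0 \<le> v" using v(4) by (simp add: b4_def)
    obtain P X where PX: "P \<subseteq> C" "matching_of blk P" "X \<subseteq> Orb" "real (card X) \<le> K0 + e3 * real (card Orb)"
      "\<forall>ob\<in>X. card (P \<inter> ob) = s - 1" "\<forall>ob\<in>Orb - X. card (P \<inter> ob) = s"
      using parallel_class_if_large[OF \<delta>1(2) \<delta>3(2) s l v(6) e1 e3(2) \<delta>1(1) \<delta>3(1) p_def _ n1 n2 n3 n5] unfolding K0_def by blast
    have "1 * (v - 1) \<le> l * (v - 1)" using l by (intro mult_le_mono) auto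
    also have "\<dots> \<le> k * (k - 1) * card Orb" by (rule card_Orb_lower[OF v(6)])
    also have "\<dots> \<le> k * k * card Orb" by (intro mult_le_mono) auto
    finally have "v \<le> k * k * card Orb + 1" by linarith
    then have "real v \<le> real (k * k * card Orb + 1)" by (simp only: of_nat_le_iff)
    then have "real v \<le> (real k)\<^sup>2 * real (card Orb) + 1" by (simp add: power2_eq_square)
    then have "2 * K0 * (real k)\<^sup>2 / \<epsilon> \<le> (real k)\<^sup>2 * real (card Orb)" using v(5) by (simp add: b5_def)
    then have "(real k)\<^sup>2 * (2 * K0) \<le> (real k)\<^sup>2 * (\<epsilon> * real (card Orb))"
      using \<epsilon> by (simp add: pos_divide_le_eq mult_ac)
    then have "2 * K0 \<le> \<epsilon> * real (card Orb)" using pos by simp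
    moreover have "e3 * real (card Orb) \<le> \<epsilon> / 2 * real (card Orb)" using e3 by (intro mult_right_mono) auto
    ultimately have "real (card X) \<le> \<epsilon> * real (card Orb)" using PX(4) by linarith
    then show "\<exists>P X. P \<subseteq> C \<and> matching_of blk P \<and> X \<subseteq> Orb \<and> real (card X) \<le> \<epsilon> * real (card Orb)
      \<and> (\<forall>ob\<in>X. card (P \<inter> ob) = s - 1) \<and> (\<forall>ob\<in>Orb - X. card (P \<inter> ob) = s)"
      using PX by blast
  qed
qed

subsection \<open>Cyclic designs\<close>

lemma block_copies_Sigma: "block_copies B = Sigma (set_mset B) (\<lambda>b. {..<count B b})"
proof -
  have "b \<in># B" if "i < count B b" for b and i :: nat
    using that unfolding count_greater_zero_iff[symmetric] by linarith
  then show ?thesis by (auto simp: block_copies_def)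
qed

lemma card_block_copies:
  "card {c\<in>block_copies B. Q (fst c)} = size {#b \<in># B. Q b#}"
proof -
  have "{c\<in>block_copies B. Q (fst c)} = Sigma {b\<in>set_mset B. Q b} (\<lambda>b. {..<count B b})"
    by (auto simp: block_copies_Sigma)
  then have "card {c\<in>block_copies B. Q (fst c)} = (\<Sum>b\<in>{b\<in>set_mset B. Q b}. count B b)"
    by simp
  also have "\<dots> = size {#b \<in># B. Q b#}"
    by (simp add: size_multiset_overloaded_eq)
  finally show ?thesis .
qed

lemma finite_block_copies: "finite (block_copies B)"
  by (simp add: block_copies_Sigma)

locale cyclic_orbits =
  fixes v k l :: nat and V :: "'a set" and B :: "'a set multiset" and \<sigma> :: "'a \<Rightarrow> 'a"
  assumes cyc: "cyclic_design v k l V B \<sigma>" and k: "2 \<le> k" and v: "0 < v"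
begin

lemma finV: "finite V" and cardV: "card V = v"
  and blk: "b \<in># B \<Longrightarrow> b \<subseteq> V" "b \<in># B \<Longrightarrow> card b = k"
  and pairB: "x \<in> V \<Longrightarrow> y \<in> V \<Longrightarrow> x \<noteq> y \<Longrightarrow> size {#b \<in># B. x \<in> b \<and> y \<in> b#} = l"
  and perm: "\<sigma> permutes V" and inv: "image_mset (\<lambda>b. \<sigma> ` b) B = B" and cyc_on: "cyclic_on \<sigma> V"
  using cyc by (auto simp: cyclic_design_def design_def design_automorphism_def)

abbreviation shift :: "nat \<Rightarrow> 'a set \<Rightarrow> 'a set" where
  "shift n b \<equiv> (\<sigma> ^^ n) ` b"

lemma inj_pow: "inj (\<sigma> ^^ n)"
  using permutes_inj[OF permutes_funpow[OF perm]] .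

lemma pow_in: "x \<in> V \<Longrightarrow> (\<sigma> ^^ n) x \<in> V"
  using cyclic_on_funpow_in[OF cyc_on] .

lemma shift_shift: "shift m (shift n b) = shift (m + n) b"
  by (simp add: funpow_add image_comp)

lemma shift_eq_iff: "shift n b = shift n b' \<longleftrightarrow> b = b'"
  using inj_pow by (simp add: inj_image_eq_iff)

text \<open>The identification of \<open>V\<close> with the residues modulo \<open>v\<close>, with
  base point \<open>x\<close>: the return time of \<open>x\<close> must be \<open>v\<close> because
  the orbit of \<open>x\<close> is all of \<open>V\<close>.\<close>

lemma pow_period:
  assumes x: "x \<in> V"
  shows "(\<sigma> ^^ v) x = x" and "inj_on (\<lambda>n. (\<sigma> ^^ n) x) {..<v}" and "(\<lambda>n. (\<sigma> ^^ n) x) ` {..<v} = V"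
proof -
  have V: "V = orbit \<sigma> x" using cyc_on x by (simp add: cyclic_on_alldef)
  then have xo: "x \<in> orbit \<sigma> x" using x by simp
  let ?d = "funpow_dist1 \<sigma> x x"
  have inj: "inj_on (\<lambda>n. (\<sigma> ^^ n) x) {0..<?d}" by (rule inj_on_funpow_dist1[OF xo])
  have im: "V = (\<lambda>n. (\<sigma> ^^ n) x) ` {0..<?d}"
    using orbit_conv_funpow_dist1[OF xo] V by simp
  then have d: "?d = v" using card_image[OF inj] cardV by simp
  show "(\<sigma> ^^ v) x = x" using funpow_dist1_prop[OF xo] d by simp
  show "inj_on (\<lambda>n. (\<sigma> ^^ n) x) {..<v}" using inj unfolding d atLeast0LessThan .
  show "(\<lambda>n. (\<sigma> ^^ n) x) ` {..<v} = V" using im unfolding d atLeast0LessThan by simp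
qed

lemma pow_mod: "x \<in> V \<Longrightarrow> (\<sigma> ^^ (n mod v)) x = (\<sigma> ^^ n) x"
  using pow_period(1) by (rule funpow_mod_eq)

lemma pow_eq_iff:
  assumes "x \<in> V"
  shows "(\<sigma> ^^ n) x = (\<sigma> ^^ m) x \<longleftrightarrow> n mod v = m mod v"
proof
  assume "(\<sigma> ^^ n) x = (\<sigma> ^^ m) x"
  then have "(\<sigma> ^^ (n mod v)) x = (\<sigma> ^^ (m mod v)) x" by (simp add: pow_mod[OF assms])
  then show "n mod v = m mod v"
    by (rule inj_onD[OF pow_period(2)[OF assms]]) (use v in auto)
next
  assume "n mod v = m mod v"
  then show "(\<sigma> ^^ n) x = (\<sigma> ^^ m) x" using pow_mod[OF assms, of n] pow_mod[OF assms, of m] by simp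
qed

lemma shift_mod: "b \<subseteq> V \<Longrightarrow> shift (n mod v) b = shift n b"
  using pow_mod by (intro image_cong) auto

lemma count_shift: "count B (shift n b) = count B b"
proof (induction n)
  case (Suc n)
  have inj: "inj (\<lambda>b. \<sigma> ` b)" using permutes_inj[OF perm] by (auto intro!: injI simp: inj_image_eq_iff)
  have one: "count B (\<sigma> ` b) = count B b" for b
  proof -
    have "(\<lambda>b. \<sigma> ` b) -` {\<sigma> ` b} = {b}" using inj by (auto dest: injD)
    then have "count (image_mset (\<lambda>b. \<sigma> ` b) B) (\<sigma> ` b) = sum (count B) ({b} \<inter> set_mset B)"
      by (simp add: count_image_mset)
    also have "\<dots> = count B b" by (cases "b \<in># B") (auto simp: not_in_iff)
    finally show ?thesis by (simp add: inv)
  qed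
  have "shift (Suc n) b = \<sigma> ` shift n b" by (simp add: image_comp)
  then show ?case using one Suc by simp
qed simp

section \<open>Orbits of block copies\<close>

definition orb :: "'a set \<times> nat \<Rightarrow> ('a set \<times> nat) set" where
  "orb c = {(shift n (fst c), snd c) | n. True}"

lemma block_orbits_eq: "block_orbits \<sigma> B = orb ` block_copies B"
  by (auto simp: block_orbits_def orb_def case_prod_unfold)

lemma copies: "c \<in> block_copies B \<Longrightarrow> fst c \<subseteq> V" "c \<in> block_copies B \<Longrightarrow> card (fst c) = k"
  using blk[of "fst c"] by (auto simp: block_copies_Sigma)

lemma orb_refl: "c \<in> orb c"
  unfolding orb_def using prod.collapse[of c] by (auto intro!: exI[of _ "0::nat"])

lemma orb_copies: "c \<in> block_copies B \<Longrightarrow> orb c \<subseteq> block_copies B"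
  by (auto simp: orb_def block_copies_def count_shift)

lemma orb_eq:
  assumes c: "c \<in> block_copies B" and c': "c' \<in> orb c"
  shows "orb c' = orb c"
proof -
  obtain n where n: "c' = (shift n (fst c), snd c)" using c' by (auto simp: orb_def)
  \<comment> \<open>With nonnegative powers only, the shift by \<open>n\<close> is undone by
    completing \<open>n\<close> to a multiple of \<open>v\<close>.\<close>
  have "n + (v - n mod v) = (n - n mod v) + v"
    using mod_less_divisor[OF v, of n] mod_less_eq_dividend[of n v] by linarith
  then have "(n + (v - n mod v)) mod v = 0" by (simp add: minus_mod_eq_mult_div)
  then have undo: "shift (v - n mod v) (shift n (fst c)) = fst c"
    using shift_mod[OF copies(1)[OF c], of "n + (v - n mod v)"] by (simp add: shift_shift add.commute)
  have "shift m (fst c) = shift (m + (v - n mod v)) (shift n (fst c))" for m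
    by (simp only: shift_shift[symmetric] undo)
  then show ?thesis unfolding orb_def n by (auto simp: shift_shift) blast
qed

lemma orb_image:
  assumes "c \<in> block_copies B"
  shows "orb c = (\<lambda>n. (shift n (fst c), snd c)) ` {..<v}"
proof
  show "orb c \<subseteq> (\<lambda>n. (shift n (fst c), snd c)) ` {..<v}"
  proof
    fix d assume "d \<in> orb c"
    then obtain n where "d = (shift n (fst c), snd c)" by (auto simp: orb_def)
    then have "d = (shift (n mod v) (fst c), snd c)" using shift_mod[OF copies(1)[OF assms]] by simp
    then show "d \<in> (\<lambda>n. (shift n (fst c), snd c)) ` {..<v}" using v by (intro image_eqI[of _ _ "n mod v"]) auto
  qed
qed (auto simp: orb_def)

lemma finite_orb: "c \<in> block_copies B \<Longrightarrow> finite (orb c)"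
  by (simp add: orb_image)

text \<open>Each point of the block is carried to \<open>x\<close> by at most one shift below
  \<open>v\<close>. Counting shifts instead of blocks can only overcount when the orbit is
  short.\<close>

lemma orb_through:
  assumes c: "c \<in> block_copies B"
  shows "card {d\<in>orb c. x \<in> fst d} \<le> k"
proof -
  let ?b = "fst c"
  have fin: "finite ?b" using copies(1)[OF c] finV by (rule finite_subset)
  have "{n\<in>{..<v}. x \<in> shift n ?b} = (\<Union>y\<in>?b. {n\<in>{..<v}. (\<sigma> ^^ n) y = x})" by auto
  also have "card \<dots> \<le> (\<Sum>y\<in>?b. card {n\<in>{..<v}. (\<sigma> ^^ n) y = x})" by (rule card_UN_le[OF fin])
  also have "\<dots> \<le> (\<Sum>y\<in>?b. 1)"
  proof (rule sum_mono)
    fix y assume "y \<in> ?b"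
    then have "y \<in> V" using copies(1)[OF c] by blast
    then have "n = m" if "n \<in> {n\<in>{..<v}. (\<sigma> ^^ n) y = x}" "m \<in> {n\<in>{..<v}. (\<sigma> ^^ n) y = x}" for n m
      using that pow_eq_iff[of y n m] by simp
    then show "card {n\<in>{..<v}. (\<sigma> ^^ n) y = x} \<le> 1"
      using card_le_Suc0_iff_eq[of "{n\<in>{..<v}. (\<sigma> ^^ n) y = x}"] by auto
  qed
  also have "\<dots> = k" using copies(2)[OF c] by simp
  finally have "card {n\<in>{..<v}. x \<in> shift n ?b} \<le> k" .
  moreover have "{d\<in>orb c. x \<in> fst d} \<subseteq> (\<lambda>n. (shift n ?b, snd c)) ` {n\<in>{..<v}. x \<in> shift n ?b}"
    by (auto simp: orb_image[OF c])
  then have "card {d\<in>orb c. x \<in> fst d} \<le> card {n\<in>{..<v}. x \<in> shift n ?b}"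
    by (intro surj_card_le) auto
  ultimately show ?thesis by linarith
qed

lemma orb_covers:
  assumes c: "c \<in> block_copies B" and x: "x \<in> V"
  shows "\<exists>d\<in>orb c. x \<in> fst d"
proof -
  have "fst c \<noteq> {}" using copies(2)[OF c] k by auto
  then obtain y where y: "y \<in> fst c" by blast
  then have "y \<in> V" using copies(1)[OF c] by blast
  then obtain n where "x = (\<sigma> ^^ n) y" using pow_period(3)[of y] x by blast
  then show ?thesis using y by (intro bexI[of _ "(shift n (fst c), snd c)"]) (auto simp: orb_def)
qed

text \<open>The translates of a nonempty block cover \<open>V\<close> by transitivity, whether the
  orbit is full or short.\<close>

lemma orb_large:
  assumes c: "c \<in> block_copies B"
  shows "v \<le> k * card (orb c)"
proof -
  have fin: "finite (\<Union>d\<in>orb c. fst d)"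
    using orb_copies[OF c] copies(1) finite_subset[OF _ finV] by (intro finite_UN_I finite_orb[OF c]) blast
  have "V \<subseteq> (\<Union>d\<in>orb c. fst d)" using orb_covers[OF c] by blast
  then have "v \<le> card (\<Union>d\<in>orb c. fst d)" unfolding cardV[symmetric] by (rule card_mono[OF fin])
  also have "\<dots> \<le> (\<Sum>d\<in>orb c. card (fst d))" by (rule card_UN_le[OF finite_orb[OF c]])
  also have "\<dots> = (\<Sum>d\<in>orb c. k)" using copies(2) orb_copies[OF c] by (intro sum.cong) auto
  finally show ?thesis by (simp add: mult.commute)
qed

lemma card_orb_le: "c \<in> block_copies B \<Longrightarrow> card (orb c) \<le> v"
  using card_image_le[of "{..<v}" "\<lambda>n. (shift n (fst c), snd c)"] by (simp add: orb_image)

text \<open>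
  A block \<open>b\<close> with \<open>b + h = b\<close> contains \<open>x, x + h, \<dots>, x + k h\<close> along with \<open>x\<close>, and \<open>b\<close> has only
  \<open>k\<close> elements, so \<open>v\<close> divides \<open>m h\<close> for some \<open>m \<le> k\<close>.
\<close>

lemma short_period:
  assumes b: "b \<subseteq> V" "card b = k" and h: "shift h b = b" "h < v" and x: "x \<in> b"
  shows "\<exists>m\<in>{1..k}. \<exists>c\<in>{..k}. h = c * v div m"
proof -
  have inb: "(\<sigma> ^^ (j * h)) x \<in> b" for j
  proof (induction j)
    case (Suc j)
    have "(\<sigma> ^^ (Suc j * h)) x = (\<sigma> ^^ h) ((\<sigma> ^^ (j * h)) x)" by (simp add: funpow_add)
    then show ?case using Suc h(1) by blast
  qed (use x in simp)
  have "(\<lambda>j. (\<sigma> ^^ (j * h)) x) ` {..k} \<subseteq> b" using inb by blast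
  then have "card ((\<lambda>j. (\<sigma> ^^ (j * h)) x) ` {..k}) \<le> k"
    using card_mono[OF finite_subset[OF b(1) finV]] b(2) by blast
  then have "\<not> inj_on (\<lambda>j. (\<sigma> ^^ (j * h)) x) {..k}" by (intro pigeonhole) simp
  then obtain i j where ij: "i < j" "j \<le> k" "(\<sigma> ^^ (i * h)) x = (\<sigma> ^^ (j * h)) x"
    unfolding inj_on_def by (metis atMost_iff nat_neq_iff)
  have "x \<in> V" using x b by blast
  then have "i * h mod v = j * h mod v" using ij(3) by (simp add: pow_eq_iff)
  then have "v dvd j * h - i * h" using mod_eq_dvd_iff_nat[of "i * h" "j * h" v] ij(1) by auto
  then obtain c where c: "(j - i) * h = v * c" by (auto simp: diff_mult_distrib elim: dvdE)
  have "v * c \<le> v * k" unfolding c[symmetric] using mult_le_mono[of "j - i" k h v] ij h(2) by (simp add: mult.commute)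
  then have "c \<le> k" using v by simp
  \<comment> \<open>The division is exact. It makes \<open>h\<close> a function of two numbers up to
    \<open>k\<close>, so there are at most \<open>k * (k + 1)\<close> possible periods, whatever
    \<open>v\<close> is.\<close>
  moreover have "h = c * v div (j - i)" using c ij(1) by (metis mult.commute nonzero_mult_div_cancel_left zero_less_diff less_numeral_extra(3))
  ultimately show ?thesis using ij by (intro bexI[of _ "j - i"] bexI[of _ c]) auto
qed

lemma card_pair:
  assumes "x \<in> V" "y \<in> V" "x \<noteq> y"
  shows "card {c\<in>block_copies B. x \<in> fst c \<and> y \<in> fst c} = l"
  using card_block_copies[of B "\<lambda>b. x \<in> b \<and> y \<in> b"] pairB[OF assms] by simp

text \<open>Every short orbit has a block \<open>d\<close> through a fixed point \<open>x\<close>,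
  and \<open>d\<close> has a period \<open>h\<close> from the small set \<open>S\<close>. So
  \<open>d\<close> also contains \<open>(\<sigma> ^^ h) x\<close>, and only \<open>l\<close> block
  copies contain this pair for each \<open>h\<close>.\<close>

lemma card_short: "card {ob\<in>block_orbits \<sigma> B. card ob \<noteq> v} \<le> l * (k * (k + 1))"
proof -
  obtain x where x: "x \<in> V" using v cardV by fastforce
  define S where "S = {h\<in>(\<lambda>(m, c). c * v div m) ` ({1..k} \<times> {..k}). 0 < h \<and> h < v}"
  define D where "D = (\<Union>h\<in>S. {c\<in>block_copies B. x \<in> fst c \<and> (\<sigma> ^^ h) x \<in> fst c})"
  have "card S \<le> card ((\<lambda>(m, c). c * v div m) ` ({1..k} \<times> {..k}))"
    unfolding S_def by (intro card_mono) auto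
  also have "\<dots> \<le> card ({1..k} \<times> {..k})" by (intro card_image_le) auto
  also have "\<dots> = k * (k + 1)" by (simp add: card_cartesian_product)
  finally have cS: "card S \<le> k * (k + 1)" .
  have finS: "finite S" by (simp add: S_def)
  have "card D \<le> (\<Sum>h\<in>S. card {c\<in>block_copies B. x \<in> fst c \<and> (\<sigma> ^^ h) x \<in> fst c})"
    unfolding D_def by (rule card_UN_le[OF finS])
  also have "\<dots> = (\<Sum>h\<in>S. l)"
  proof (rule sum.cong[OF refl])
    fix h assume "h \<in> S"
    then have "x \<noteq> (\<sigma> ^^ h) x" using pow_eq_iff[OF x, of 0 h] by (auto simp: S_def)
    then show "card {c\<in>block_copies B. x \<in> fst c \<and> (\<sigma> ^^ h) x \<in> fst c} = l"
      by (intro card_pair x pow_in)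
  qed
  also have "\<dots> \<le> l * (k * (k + 1))" using cS by (simp add: mult.commute)
  finally have cD: "card D \<le> l * (k * (k + 1))" .
  have finD: "finite D" unfolding D_def using finS finite_block_copies[of B] by auto
  have "{ob\<in>block_orbits \<sigma> B. card ob \<noteq> v} \<subseteq> orb ` D"
  proof
    fix ob assume "ob \<in> {ob\<in>block_orbits \<sigma> B. card ob \<noteq> v}"
    then obtain c where c: "c \<in> block_copies B" "ob = orb c" "card (orb c) \<noteq> v"
      by (auto simp: block_orbits_eq)
    then have "\<not> inj_on (\<lambda>n. (shift n (fst c), snd c)) {..<v}"
      using card_image[of "\<lambda>n. (shift n (fst c), snd c)" "{..<v}"] by (auto simp: orb_image)
    then obtain i j where ij: "i < j" "j < v" "shift i (fst c) = shift j (fst c)"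
      unfolding inj_on_def by (metis (no_types, lifting) lessThan_iff linorder_neqE_nat fst_conv)
    define h where "h = j - i"
    have "shift i (fst c) = shift i (shift h (fst c))" using ij by (simp add: shift_shift h_def)
    then have hc: "shift h (fst c) = fst c" by (simp add: shift_eq_iff)
    obtain d where d: "d \<in> orb c" "x \<in> fst d" using orb_covers[OF c(1) x] by blast
    have dB: "d \<in> block_copies B" using d orb_copies[OF c(1)] by blast
    obtain n where n: "fst d = shift n (fst c)" using d by (auto simp: orb_def)
    \<comment> \<open>Translations commute, so a period of one block is a period of its whole
      orbit.\<close>
    have hd: "shift h (fst d) = fst d"
      unfolding n shift_shift add.commute[of h] by (simp only: shift_shift[symmetric] hc)
    have "h < v" "0 < h" using ij by (auto simp: h_def)
    then obtain m e where "m \<in> {1..k}" "e \<in> {..k}" "h = e * v div m"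
      using short_period[OF copies[OF dB] hd _ d(2)] by blast
    then have "h \<in> S" using \<open>h < v\<close> \<open>0 < h\<close> by (auto simp: S_def intro!: image_eqI[of _ _ "(m, e)"])
    moreover have "(\<sigma> ^^ h) x \<in> fst d" using hd d(2) by blast
    ultimately have "d \<in> D" using dB d(2) by (auto simp: D_def)
    then show "ob \<in> orb ` D" using orb_eq[OF c(1) d(1)] c(2) by blast
  qed
  then have "card {ob\<in>block_orbits \<sigma> B. card ob \<noteq> v} \<le> card D"
    using finD by (intro surj_card_le)
  then show ?thesis using cD by linarith
qed

text \<open>Double counting of the pairs formed by a block through \<open>x\<close> and a second
  point on it.\<close>

lemma card_degree:
  assumes x: "x \<in> V"
  shows "(k - 1) * card {c\<in>block_copies B. x \<in> fst c} = l * (v - 1)"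
proof -
  let ?F = "{c\<in>block_copies B. x \<in> fst c}"
  have "(\<Sum>c\<in>?F. card {y\<in>V - {x}. y \<in> fst c}) = (\<Sum>y\<in>V - {x}. card {c\<in>?F. y \<in> fst c})"
    using finV finite_block_copies[of B] by (intro sum_multicount_gen) auto
  also have "\<dots> = (\<Sum>y\<in>V - {x}. l)"
    using card_pair[OF x] by (intro sum.cong) (auto simp: conj_assoc)
  also have "\<dots> = l * (v - 1)" using x cardV finV by simp
  finally have "(\<Sum>c\<in>?F. card {y\<in>V - {x}. y \<in> fst c}) = l * (v - 1)" .
  moreover have "(\<Sum>c\<in>?F. card {y\<in>V - {x}. y \<in> fst c}) = (\<Sum>c\<in>?F. k - 1)"
  proof (rule sum.cong[OF refl])
    fix c assume c: "c \<in> ?F"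
    then have "{y\<in>V - {x}. y \<in> fst c} = fst c - {x}" using copies(1) by blast
    then show "card {y\<in>V - {x}. y \<in> fst c} = k - 1" using c copies(2) by simp
  qed
  ultimately show ?thesis by (simp add: mult.commute)
qed

text \<open>The bound on short orbits depends on \<open>k\<close> and \<open>l\<close> only, so
  \<open>v0\<close> can be chosen uniformly for all designs.\<close>

lemma orbits_block_system: "block_system V (block_copies B) fst (block_orbits \<sigma> B) v k l (l * (k * (k + 1)))"
proof
  show "\<Union>(block_orbits \<sigma> B) = block_copies B"
    using orb_refl orb_copies by (fastforce simp: block_orbits_eq)
  have orbitE: "\<exists>c\<in>block_copies B. ob = orb c" if "ob \<in> block_orbits \<sigma> B" for ob
    using that by (auto simp: block_orbits_eq)
  show "o1 = o2" if "o1 \<in> block_orbits \<sigma> B" "o2 \<in> block_orbits \<sigma> B" "c \<in> o1" "c \<in> o2" for o1 o2 c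
    using orbitE[OF that(1)] orbitE[OF that(2)] that(3,4) by (metis orb_eq)
  show "card {c\<in>ob. x \<in> fst c} \<le> k" if "ob \<in> block_orbits \<sigma> B" for ob x
    using orbitE[OF that] orb_through by blast
  show "v \<le> k * card ob" if "ob \<in> block_orbits \<sigma> B" for ob
    using orbitE[OF that] orb_large by blast
  show "card ob \<le> v" if "ob \<in> block_orbits \<sigma> B" for ob
    using orbitE[OF that] card_orb_le by blast
  show "fst c \<subseteq> V" "card (fst c) = k" if "c \<in> block_copies B" for c
    using copies[OF that] .
  show "(k - 1) * card {c\<in>block_copies B. x \<in> fst c} = l * (v - 1)" if "x \<in> V" for x
    using card_degree[OF that] .
  show "card {c\<in>block_copies B. x \<in> fst c \<and> y \<in> fst c} = l" if "x \<in> V" "y \<in> V" "x \<noteq> y" for x y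
    using card_pair[OF that] .
qed (rule finV cardV finite_block_copies card_short k)+

end

theorem theorem4:
  fixes k l s :: nat and \<epsilon> :: real
  assumes "0 < k" and "0 < l" and "2 * l + 1 \<le> k"
    and "s = (k - 1) div l"
    and "0 < \<epsilon>"
  shows "\<exists>v0::nat. \<forall>v\<ge>v0. \<forall>(V :: 'a set) B \<sigma> t.
           cyclic_design v k l V B \<sigma> \<and> t = card (block_orbits \<sigma> B) \<longrightarrow>
           (\<exists>P X. partial_parallel_class B P \<and>
              X \<subseteq> block_orbits \<sigma> B \<and> real (card X) \<le> \<epsilon> * real t \<and>
              (\<forall>orb\<in>X. card (P \<inter> orb) = s - 1) \<and>
              (\<forall>orb\<in>block_orbits \<sigma> B - X. card (P \<inter> orb) = s))"
proof -
  \<comment> \<open>\<open>2 * l + 1 \<le> k\<close> amounts to \<open>2 \<le> s\<close>. The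
    density \<open>1 / s\<close> of \<open>U\<close> is then at most one half, which gives
    \<open>q \<le> Q\<close> in the assembly.\<close>
  have s: "2 \<le> s" "s * l \<le> k - 1"
    using assms(2,3) unfolding assms(4) by (simp_all add: less_eq_div_iff_mult_less_eq)
  obtain v0 where v0: "\<forall>v\<ge>v0. \<forall>(V :: 'a set) (C :: ('a set \<times> nat) set) blk Orb.
      block_system V C blk Orb v k l (l * (k * (k + 1))) \<longrightarrow>
      (\<exists>P X. P \<subseteq> C \<and> matching_of blk P \<and> X \<subseteq> Orb \<and> real (card X) \<le> \<epsilon> * real (card Orb)
      \<and> (\<forall>ob\<in>X. card (P \<inter> ob) = s - 1) \<and> (\<forall>ob\<in>Orb - X. card (P \<inter> ob) = s))"
    using block_system_parallel_class[OF s assms(2,5), of "l * (k * (k + 1))"] by (elim exE)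
  show ?thesis
  \<comment> \<open>The added 1 guarantees a nonempty point set, as \<open>cyclic_orbits\<close>
    demands.\<close>
  proof (intro exI[of _ "v0 + 1"] allI impI)
    fix v t and V :: "'a set" and B \<sigma>
    assume v_ge: "v0 + 1 \<le> v" and *: "cyclic_design v k l V B \<sigma> \<and> t = card (block_orbits \<sigma> B)"
    interpret cyclic_orbits v k l V B \<sigma>
      using * v_ge assms(2,3) by unfold_locales auto
    have "v0 \<le> v" using v_ge by simp
    then obtain P X where "P \<subseteq> block_copies B" "matching_of fst P" "X \<subseteq> block_orbits \<sigma> B"
      "real (card X) \<le> \<epsilon> * real (card (block_orbits \<sigma> B))"
      "\<forall>ob\<in>X. card (P \<inter> ob) = s - 1" "\<forall>ob\<in>block_orbits \<sigma> B - X. card (P \<inter> ob) = s"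
      using v0[THEN spec, THEN mp, THEN spec, THEN spec, THEN spec, THEN spec, THEN mp, OF _ orbits_block_system] by blast
    then show "\<exists>P X. partial_parallel_class B P \<and>
              X \<subseteq> block_orbits \<sigma> B \<and> real (card X) \<le> \<epsilon> * real t \<and>
              (\<forall>orb\<in>X. card (P \<inter> orb) = s - 1) \<and>
              (\<forall>orb\<in>block_orbits \<sigma> B - X. card (P \<inter> orb) = s)"
      using * unfolding partial_parallel_class_def matching_of_def by blast
  qed
qed

end
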